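(* Let $1\le j\le n-1$ and $1\le i\le rj-1$, and let $\overline{h_{i,j}}=\overline{t^{-i}y^j}$ be the corresponding element of the basis of $H^1(X_0,\mathcal O_{X_0})$. Let $a$ be the quotient and $b$ the remainder of the Euclidean division of $pj$ by $n$. Put $F(t)=f(t)^a$ and let $F[k]$ denote the coefficient of $t^k$ in $F$. Then $1\le b\le n-1$ and $$P_1\bigl(\Phi(\overline{h_{i,j}})\bigr)=\overline{h_{i,j}^p}=\sum_{k=1}^{rb-1}F[pi-k]\,\overline{t^{-k}y^b}=\sum_{k=1}^{rb-1}F[pi-k]\,\overline{h_{k,b}}$$ in $H^1(X_0,\mathcal O_{X_0})$.
   Context: **Curve.** Let $p$ be a prime, $k$ a finite field of characteristic $p$, $W=W(k)$ its ring of Witt vectors, $W_1=W/p^2W$. Let $n\ge 1$ be an integer prime to $p$, $l\ge 1$ an integer with $l\equiv -1 \pmod n$ and $p\nmid l$, and $r=(l+1)/n$. Let $\mathbf f\in W[t]$ be a polynomial of degree $l$ such that $\mathbf f$ and its derivative $\mathbf f'$ generate the unit ideal of $W[t]$, and let $\mathbf f_2(s)=\mathbf f(1/s)s^{l+1}\in W[s]$. Write $f\in k[t]$, $f_2\in k[s]$ for their reductions modulo $p$; it is assumed that $\deg f=l$ and that $f(0)\neq 0$. $X$ is the curve over $\mathrm{Spec}(W)$ obtained by gluing $\mathrm{Spec}(W[t,y]/(y^n-\mathbf f(t)))$ and $\mathrm{Spec}(W[s,z]/(z^n-\mathbf f_2(s)))$ along $t\ne0$, $s\neq 0$ via $t=s^{-1}$,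 $z=s^ry$. Its special fibre $X_0$ over $k$ is the gluing of $\mathcal U=\mathrm{Spec}(k[t,y]/(y^n-f(t)))$ and $\mathcal V=\mathrm{Spec}(k[s,z]/(z^n-f_2(s)))$. Put $\overline{\mathcal U}=\mathcal U\cap D(y)$; then $X_0=\overline{\mathcal U}\cup\mathcal V$. Coefficients of a polynomial at indices that are negative or larger than the degree are $0$. **Bases.** $H^0(X_0,\Omega^1_{X_0})$ has $k$-basis $\omega_{i,j}=t^iy^{-j}dt$ ($1\le j\le n-1$, $0\le i\le rj-2$). $H^1(X_0,\mathcal O_{X_0})=\mathcal O_{X_0}(\overline{\mathcal U}\cap\mathcal V)/(\mathcal O_{X_0}(\overline{\mathcal U})+\mathcal O_{X_0}(\mathcal V))$ has $k$-basis the classes $\overline{h_{i,j}}$ of $h_{i,j}=t^{-i}y^j$ ($1\le j\le n-1$, $1\le i\le rj-1$); $\overline{x}$ denotes the class of $x\in \mathcal O_{X_0}(\overline{\mathcal U}\cap\mathcal V)$. **De Rham cohomology and splitting.** $H^1_{DR}(X_0)$ is the space of triples $(\omega_U,\omega_V,h)\in\Omega^1_{X_0}(\overline{\mathcal U})\oplus\Omega^1_{X_0}(\mathcal V)\oplus\mathcal O_{X_0}(\overline{\mathcal U}\cap\mathcal V)$ with $\omega_V-\omega_U+dh=0$ modulo triples $(dh_U,-dh_V,h_U+h_V)$, $h_U\in\mathcal O_{X_0}(\overline{\mathcal U})$, $h_V\in\mathcal O_{X_0}(\mathcal V)$; $[\cdot]$ denotes the class. Let $\lambda_m$ be the coefficient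 of $t^m$ in $f$. For $1\le j\le n-1$, $1\le i\le rj-1$ set $$\alpha^{\mathcal U}_{i,j}=\Bigl[\sum_{m=i+1}^l\tfrac{jm-in}{n}\lambda_mt^{m-(i+1)}\Bigr]y^{j-1}\tfrac{dt}{y^{n-1}},\qquad \alpha^{\mathcal V}_{i,j}=\Bigl[\sum_{m=0}^i\tfrac{in-jm}{n}\lambda_ms^{i+1+(n-j)r-2-m}\Bigr]z^{j-1}\tfrac{ds}{z^{n-1}},$$ so that $dh_{i,j}=\alpha^{\mathcal U}_{i,j}+\alpha^{\mathcal V}_{i,j}$; let $\tau$ be the $k$-linear map with $\tau(\overline{h_{i,j}})=(\alpha^{\mathcal U}_{i,j},-\alpha^{\mathcal V}_{i,j},h_{i,j})$. One identifies $H^0(X_0,\Omega^1_{X_0})\oplus H^1(X_0,\mathcal O_{X_0})$ with $H^1_{DR}(X_0)$ by $(\omega,x)\mapsto[(\omega|_{\overline{\mathcal U}},\omega|_{\mathcal V},0)]+[\tau(x)]$. $P_2$ (resp. $P_1$) is the projection to $H^0(X_0,\Omega^1_{X_0})$ (resp. $H^1(X_0,\mathcal O_{X_0})$). **Divided Frobenius $\Phi$.** Let $\sigma$ be the Frobenius of $k$ and its lift to $W$ and $W_1$; $Q^\sigma$ means $\sigma$ applied to the coefficients of $Q$; $X_0'$ is the base change of $X_0$ by $\sigma$ (given by $f^\sigma,f_2^\sigma$), with analogous bases $\omega'_{i,j}=t^iy^{-j}dt$, $\overline{h'_{i,j}}=\overline{t^{-i}y^j}$. For $x\in k[s]$, $px\in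 W_1[s]$ means $p$ times any lift of $x$. Fix $v,c\in k[s]$ with $\mathbf f_2(s)^p-\mathbf f_2^\sigma(s^p)=p\,(v(s)f_2'(s)^p-n\,c(s)f_2(s)^p)$ in $W_1[s]$; then $s\mapsto s^p+pv(s)$, $z\mapsto z^p+pz^pc(s)$ is a lift modulo $p^2$ of the relative Frobenius on $\mathcal V$, while on $\overline{\mathcal U}$ one uses the lift sending $t\mapsto t^p$ and $y\mapsto y^p+py^p\frac{\mathcal P(t)}{n}y^{-np}$, where $p\mathcal P(t)=\mathbf f^\sigma(t^p)-\mathbf f(t)^p$. Let $F^\#$ be the $k$-linear relative Frobenius ($t\mapsto t^p$, $y\mapsto y^p$, $s\mapsto s^p$, $z\mapsto z^p$), and let $f_U,f_V,h$ be the $F^\#$-linear maps from $\Omega^1_{X'_0}$ (on $\overline{\mathcal U}'$, $\mathcal V'$, $\overline{\mathcal U}'\cap\mathcal V'$) to $\Omega^1_{X_0}(\overline{\mathcal U})$, $\Omega^1_{X_0}(\mathcal V)$, $\mathcal O_{X_0}(\overline{\mathcal U}\cap\mathcal V)$ with $f_U(dt)=t^{p-1}dt$, $f_V(ds)=(s^{p-1}+v'(s))ds$, $h(dt)=t^{2p}v(s)$; they satisfy $f_V-f_U+dh=0$. The Deligne–Illusie map $\Phi':H^0(X_0',\Omega^1_{X_0'})\oplus H^1(X'_0,\mathcal O_{X'_0})\to H^1_{DR}(X_0)$ is $\Phi'(\omega')=[(f_U(\omega'),f_V(\omega'),h(\omega'))]$, $\Phi'(\overline{x'})=[(0,0,F^\#(x'))]$.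 The divided Frobenius modulo $p$ is the $\sigma$-semilinear map $\Phi:H^0(X_0,\Omega^1_{X_0})\oplus H^1(X_0,\mathcal O_{X_0})\to H^1_{DR}(X_0)$ with $\Phi(\omega_{i,j})=\Phi'(\omega'_{i,j})$, $\Phi(\overline{h_{i,j}})=\Phi'(\overline{h'_{i,j}})$ (its coincidence with the crystalline divided Frobenius modulo $p$ is a cited theorem of Huyghe–Wach). *)

theory Defs
  imports
    "HOL-Algebra.QuotRing"
    "HOL-Algebra.Module"
    "HOL-Computational_Algebra.Computational_Algebra"
    "HOL-Library.Poly_Mapping"
    "HOL-Library.Product_Plus"
begin

section \<open>Quotients, products and semilinear maps\<close>

definition univ_ring :: "'a::comm_ring_1 ring"
  where "univ_ring = \<lparr>carrier = UNIV, monoid.mult = (*), one = 1, ring.zero = 0, ring.add = (+)\<rparr>"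

text \<open>In records used only as modules the fields \<open>mult\<close> and \<open>one\<close> are irrelevant.\<close>

definition quot_module :: "('c, 'm) module \<Rightarrow> 'm set \<Rightarrow> ('c, 'm set) module"
  where "quot_module M N =
    \<lparr>carrier = a_rcosets\<^bsub>M\<^esub> N, monoid.mult = undefined, one = undefined, ring.zero = N, ring.add = set_add M,
     module.smult = (\<lambda>a X. \<Union>x\<in>X. N +>\<^bsub>M\<^esub> (a \<odot>\<^bsub>M\<^esub> x))\<rparr>"

definition prod_module :: "('c, 'a) module \<Rightarrow> ('c, 'b) module \<Rightarrow> ('c, 'a \<times> 'b) module"
  where "prod_module M N =
    \<lparr>carrier = carrier M \<times> carrier N, monoid.mult = undefined, one = undefined,
     ring.zero = (\<zero>\<^bsub>M\<^esub>, \<zero>\<^bsub>N\<^esub>),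
     ring.add = (\<lambda>(x, y) (x', y'). (x \<oplus>\<^bsub>M\<^esub> x', y \<oplus>\<^bsub>N\<^esub> y')),
     module.smult = (\<lambda>c (x, y). (c \<odot>\<^bsub>M\<^esub> x, c \<odot>\<^bsub>N\<^esub> y))\<rparr>"

text \<open>An \<open>A\<close>-module regarded as a module over the base ring of the algebra \<open>A\<close>.\<close>

definition base_module :: "('c, 'a) module \<Rightarrow> ('a, 'm) module \<Rightarrow> ('c, 'm) module"
  where "base_module A M =
    \<lparr>carrier = carrier M, monoid.mult = undefined, one = undefined, ring.zero = ring.zero M, ring.add = ring.add M,
     module.smult = (\<lambda>c x. (c \<odot>\<^bsub>A\<^esub> \<one>\<^bsub>A\<^esub>) \<odot>\<^bsub>M\<^esub> x)\<rparr>"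

definition self_module :: "('c, 'a) module \<Rightarrow> ('a, 'a) module"
  where "self_module A =
    \<lparr>carrier = carrier A, monoid.mult = undefined, one = undefined, ring.zero = ring.zero A, ring.add = ring.add A,
     module.smult = monoid.mult A\<rparr>"

text \<open>\<open>f\<close> is an additive map \<open>M \<rightarrow> N\<close>, semilinear along a map \<open>\<phi>\<close> from the scalars \<open>R\<close> of \<open>M\<close>
  to the scalars of \<open>N\<close>.\<close>

definition semilinear ::
  "('c, 'x) ring_scheme \<Rightarrow> ('c \<Rightarrow> 'd) \<Rightarrow> ('c, 'a) module \<Rightarrow> ('d, 'b) module \<Rightarrow> ('a \<Rightarrow> 'b) \<Rightarrow> bool"
  where "semilinear R \<phi> M N f \<longleftrightarrow>
    f \<in> carrier M \<rightarrow> carrier N \<and>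
    (\<forall>x\<in>carrier M. \<forall>y\<in>carrier M. f (x \<oplus>\<^bsub>M\<^esub> y) = f x \<oplus>\<^bsub>N\<^esub> f y) \<and>
    (\<forall>a\<in>carrier R. \<forall>x\<in>carrier M. f (a \<odot>\<^bsub>M\<^esub> x) = \<phi> a \<odot>\<^bsub>N\<^esub> f x)"

text \<open>The map induced on a quotient by a map that is constant on cosets.\<close>

definition induced :: "('a \<Rightarrow> 'b) \<Rightarrow> 'a set \<Rightarrow> 'b"
  where "induced \<phi> X = the_elem (\<phi> ` X)"


section \<open>Kaehler differentials\<close>

text \<open>The free \<open>A\<close>-module on the set \<open>carrier A\<close>, its basis, and the quotient by the usual
  relations for the differentials of the \<open>k\<close>-algebra \<open>A\<close>.\<close>

definition free_module :: "('k, 'a) module \<Rightarrow> ('a, 'a \<Rightarrow> 'a) module"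
  where "free_module A =
    \<lparr>carrier = {\<phi>. (\<forall>x. \<phi> x \<in> carrier A) \<and> (\<forall>x. x \<notin> carrier A \<longrightarrow> \<phi> x = \<zero>\<^bsub>A\<^esub>) \<and>
                   finite {x. \<phi> x \<noteq> \<zero>\<^bsub>A\<^esub>}},
     monoid.mult = undefined, one = undefined,
     ring.zero = (\<lambda>x. \<zero>\<^bsub>A\<^esub>), ring.add = (\<lambda>\<phi> \<psi> x. \<phi> x \<oplus>\<^bsub>A\<^esub> \<psi> x), module.smult = (\<lambda>a \<phi> x. a \<otimes>\<^bsub>A\<^esub> \<phi> x)\<rparr>"

definition free_gen :: "('k, 'a) module \<Rightarrow> 'a \<Rightarrow> 'a \<Rightarrow> 'a"
  where "free_gen A x = (\<lambda>y. if y = x then \<one>\<^bsub>A\<^esub> else \<zero>\<^bsub>A\<^esub>)"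

definition kaehler_gens :: "('k, 'a) module \<Rightarrow> ('a \<Rightarrow> 'a) set"
  where "kaehler_gens A = (let M = free_module A; \<delta> = free_gen A in
    {\<delta> (a \<oplus>\<^bsub>A\<^esub> b) \<ominus>\<^bsub>M\<^esub> (\<delta> a \<oplus>\<^bsub>M\<^esub> \<delta> b) | a b. a \<in> carrier A \<and> b \<in> carrier A} \<union>
    {\<delta> (a \<otimes>\<^bsub>A\<^esub> b) \<ominus>\<^bsub>M\<^esub> (a \<odot>\<^bsub>M\<^esub> \<delta> b \<oplus>\<^bsub>M\<^esub> b \<odot>\<^bsub>M\<^esub> \<delta> a) | a b. a \<in> carrier A \<and> b \<in> carrier A} \<union>
    {\<delta> (c \<odot>\<^bsub>A\<^esub> \<one>\<^bsub>A\<^esub>) | c. True})"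

definition kaehler_rels :: "('k, 'a) module \<Rightarrow> ('a \<Rightarrow> 'a) set"
  where "kaehler_rels A = \<Inter>{N. submodule N A (free_module A) \<and> kaehler_gens A \<subseteq> N}"

definition kaehler :: "('k, 'a) module \<Rightarrow> ('a, ('a \<Rightarrow> 'a) set) module"
  where "kaehler A = quot_module (free_module A) (kaehler_rels A)"

definition kd :: "('k, 'a) module \<Rightarrow> 'a \<Rightarrow> ('a \<Rightarrow> 'a) set"
  where "kd A x = kaehler_rels A +>\<^bsub>free_module A\<^esub> free_gen A x"

text \<open>The map on differentials induced by an algebra map \<open>\<rho> : A \<rightarrow> B\<close>: \<open>a dx \<mapsto> \<rho>(a) d\<rho>(x)\<close>.\<close>

definition kaehler_map ::
  "('k, 'a) module \<Rightarrow> ('k, 'b) module \<Rightarrow> ('a \<Rightarrow> 'b) \<Rightarrow> ('a \<Rightarrow> 'a) set \<Rightarrow> ('b \<Rightarrow> 'b) set"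
  where "kaehler_map A B \<rho> =
    induced (\<lambda>\<phi>. \<Oplus>\<^bsub>kaehler B\<^esub>x\<in>{x. \<phi> x \<noteq> \<zero>\<^bsub>A\<^esub>}. \<rho> (\<phi> x) \<odot>\<^bsub>kaehler B\<^esub> kd B (\<rho> x))"


section \<open>The affine charts\<close>

text \<open>
  \<open>'m \<Rightarrow>\<^sub>0 'k\<close> with the convolution product is the monoid algebra \<open>k['m]\<close>:
  \<open>'m = nat \<times> int\<close> gives \<open>k[t, y, 1/y]\<close>, \<open>'m = nat \<times> nat\<close> gives \<open>k[s, z]\<close>, and
  \<open>'m = int \<times> int\<close> gives \<open>k[t, 1/t, y, 1/y]\<close>.  A localisation of \<open>k[t, y]/(y^n - f)\<close> at
  \<open>y\<close> or at \<open>ty\<close> is the corresponding (partial) Laurent polynomial ring modulo \<open>y^n - f\<close>.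
\<close>

definition cls :: "('m::comm_monoid_add \<Rightarrow>\<^sub>0 'k::comm_ring_1) \<Rightarrow> ('m \<Rightarrow>\<^sub>0 'k) \<Rightarrow> ('m \<Rightarrow>\<^sub>0 'k) set"
  where "cls g x = Idl\<^bsub>univ_ring\<^esub> {g} +>\<^bsub>univ_ring\<^esub> x"

definition coord_ring ::
  "('m::comm_monoid_add \<Rightarrow>\<^sub>0 'k::comm_ring_1) \<Rightarrow> ('k, ('m \<Rightarrow>\<^sub>0 'k) set) module"
  where "coord_ring g = (let Q = univ_ring Quot (Idl\<^bsub>univ_ring\<^esub> {g}) in
    \<lparr>carrier = carrier Q, monoid.mult = monoid.mult Q, one = one Q, ring.zero = ring.zero Q, ring.add = ring.add Q,
     module.smult = (\<lambda>c X. cls g (Poly_Mapping.single 0 c) \<otimes>\<^bsub>Q\<^esub> X)\<rparr>)"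

definition lmon :: "'m \<Rightarrow> 'm \<Rightarrow>\<^sub>0 'k::comm_ring_1"
  where "lmon m = Poly_Mapping.single m 1"

text \<open>The value \<open>q(x)\<close> of a one-variable polynomial in a monoid algebra.\<close>

definition eval_at :: "'k::comm_ring_1 poly \<Rightarrow> ('m::comm_monoid_add \<Rightarrow>\<^sub>0 'k) \<Rightarrow> ('m \<Rightarrow>\<^sub>0 'k)"
  where "eval_at q x = poly (map_poly (Poly_Mapping.single 0) q) x"

text \<open>The \<open>k\<close>-linear map of monoid algebras given on exponents by \<open>h\<close>.\<close>

definition exp_map ::
  "('m \<Rightarrow> 'm') \<Rightarrow> ('m \<Rightarrow>\<^sub>0 'k::comm_ring_1) \<Rightarrow> ('m' \<Rightarrow>\<^sub>0 'k)"
  where "exp_map h x = (\<Sum>m\<in>Poly_Mapping.keys x. Poly_Mapping.single (h m) (Poly_Mapping.lookup x m))"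

text \<open>\<open>q(1/s) s^(deg q + 1)\<close>.\<close>

definition inf_poly :: "'a::comm_ring_1 poly \<Rightarrow> 'a poly"
  where "inf_poly q = pCons 0 (reflect_poly q)"

type_synonym 'k u_poly = "(nat \<times> int) \<Rightarrow>\<^sub>0 'k"
type_synonym 'k v_poly = "(nat \<times> nat) \<Rightarrow>\<^sub>0 'k"
type_synonym 'k uv_poly = "(int \<times> int) \<Rightarrow>\<^sub>0 'k"

definition rel_U :: "nat \<Rightarrow> 'k::field poly \<Rightarrow> 'k u_poly"
  where "rel_U n f = lmon (0, int n) - eval_at f (lmon (1, 0))"

definition rel_V :: "nat \<Rightarrow> 'k::field poly \<Rightarrow> 'k v_poly"
  where "rel_V n f = lmon (0, n) - eval_at (inf_poly f) (lmon (1, 0))"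

definition rel_UV :: "nat \<Rightarrow> 'k::field poly \<Rightarrow> 'k uv_poly"
  where "rel_UV n f = lmon (0, int n) - eval_at f (lmon (1, 0))"

text \<open>\<open>U\<close> stands for the open set \<open>D(y)\<close> of the chart with coordinates \<open>t, y\<close>,
  and \<open>V\<close> for the chart with coordinates \<open>s, z\<close>.\<close>

definition O_U :: "nat \<Rightarrow> 'k::field poly \<Rightarrow> ('k, 'k u_poly set) module"
  where "O_U n f = coord_ring (rel_U n f)"

definition O_V :: "nat \<Rightarrow> 'k::field poly \<Rightarrow> ('k, 'k v_poly set) module"
  where "O_V n f = coord_ring (rel_V n f)"

definition O_UV :: "nat \<Rightarrow> 'k::field poly \<Rightarrow> ('k, 'k uv_poly set) module"
  where "O_UV n f = coord_ring (rel_UV n f)"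

abbreviation "\<Omega>_U n f \<equiv> kaehler (O_U n f)"
abbreviation "\<Omega>_V n f \<equiv> kaehler (O_V n f)"
abbreviation "\<Omega>_UV n f \<equiv> kaehler (O_UV n f)"

abbreviation "d_U n f \<equiv> kd (O_U n f)"
abbreviation "d_V n f \<equiv> kd (O_V n f)"
abbreviation "d_UV n f \<equiv> kd (O_UV n f)"

abbreviation "cls_U n f \<equiv> cls (rel_U n f)"
abbreviation "cls_V n f \<equiv> cls (rel_V n f)"
abbreviation "cls_UV n f \<equiv> cls (rel_UV n f)"

text \<open>Restriction to the overlap; on \<open>V\<close> it is the gluing \<open>s = 1/t\<close>, \<open>z = s^r y\<close>.\<close>

definition res_U :: "nat \<Rightarrow> 'k::field poly \<Rightarrow> 'k u_poly set \<Rightarrow> 'k uv_poly set"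
  where "res_U n f = induced (\<lambda>x. cls_UV n f (exp_map (\<lambda>(a, b). (int a, b)) x))"

definition res_V :: "nat \<Rightarrow> nat \<Rightarrow> 'k::field poly \<Rightarrow> 'k v_poly set \<Rightarrow> 'k uv_poly set"
  where "res_V n r f = induced (\<lambda>x. cls_UV n f
    (exp_map (\<lambda>(a, b). (- int a - int r * int b, int b)) x))"

definition res\<Omega>_U where "res\<Omega>_U n f = kaehler_map (O_U n f) (O_UV n f) (res_U n f)"

definition res\<Omega>_V where "res\<Omega>_V n r f = kaehler_map (O_V n f) (O_UV n f) (res_V n r f)"


section \<open>Cohomology\<close>

definition H0\<Omega> :: "nat \<Rightarrow> nat \<Rightarrow> 'k::field poly \<Rightarrow>
    ('k, ('k u_poly set \<Rightarrow> 'k u_poly set) set \<times> ('k v_poly set \<Rightarrow> 'k v_poly set) set) module"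
  where "H0\<Omega> n r f =
    (prod_module (base_module (O_U n f) (\<Omega>_U n f)) (base_module (O_V n f) (\<Omega>_V n f)))
    \<lparr>carrier := {(\<omega>, \<omega>'). \<omega> \<in> carrier (\<Omega>_U n f) \<and> \<omega>' \<in> carrier (\<Omega>_V n f) \<and>
                  res\<Omega>_U n f \<omega> = res\<Omega>_V n r f \<omega>'}\<rparr>"

definition coboundaries :: "nat \<Rightarrow> nat \<Rightarrow> 'k::field poly \<Rightarrow> 'k uv_poly set set"
  where "coboundaries n r f =
    {res_U n f a \<oplus>\<^bsub>O_UV n f\<^esub> res_V n r f b | a b. a \<in> carrier (O_U n f) \<and> b \<in> carrier (O_V n f)}"

definition H1O :: "nat \<Rightarrow> nat \<Rightarrow> 'k::field poly \<Rightarrow> ('k, 'k uv_poly set set) module"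
  where "H1O n r f = quot_module (O_UV n f) (coboundaries n r f)"

definition H1O_class :: "nat \<Rightarrow> nat \<Rightarrow> 'k::field poly \<Rightarrow> 'k uv_poly set \<Rightarrow> 'k uv_poly set set"
  where "H1O_class n r f x = coboundaries n r f +>\<^bsub>O_UV n f\<^esub> x"

type_synonym 'k triple =
  "('k u_poly set \<Rightarrow> 'k u_poly set) set \<times> ('k v_poly set \<Rightarrow> 'k v_poly set) set \<times> 'k uv_poly set"

definition dR_cocycles :: "nat \<Rightarrow> nat \<Rightarrow> 'k::field poly \<Rightarrow> ('k, 'k triple) module"
  where "dR_cocycles n r f =
    (prod_module (base_module (O_U n f) (\<Omega>_U n f))
       (prod_module (base_module (O_V n f) (\<Omega>_V n f)) (O_UV n f)))
    \<lparr>carrier := {(\<omega>, \<omega>', h). \<omega> \<in> carrier (\<Omega>_U n f) \<and> \<omega>' \<in> carrier (\<Omega>_V n f) \<and>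
       h \<in> carrier (O_UV n f) \<and>
       (res\<Omega>_V n r f \<omega>' \<ominus>\<^bsub>\<Omega>_UV n f\<^esub> res\<Omega>_U n f \<omega>) \<oplus>\<^bsub>\<Omega>_UV n f\<^esub> d_UV n f h = \<zero>\<^bsub>\<Omega>_UV n f\<^esub>}\<rparr>"

definition dR_coboundaries :: "nat \<Rightarrow> nat \<Rightarrow> 'k::field poly \<Rightarrow> 'k triple set"
  where "dR_coboundaries n r f =
    {(d_U n f a, \<ominus>\<^bsub>\<Omega>_V n f\<^esub> d_V n f b, res_U n f a \<oplus>\<^bsub>O_UV n f\<^esub> res_V n r f b) | a b.
       a \<in> carrier (O_U n f) \<and> b \<in> carrier (O_V n f)}"

definition H1DR :: "nat \<Rightarrow> nat \<Rightarrow> 'k::field poly \<Rightarrow> ('k, 'k triple set) module"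
  where "H1DR n r f = quot_module (dR_cocycles n r f) (dR_coboundaries n r f)"

definition dR_class :: "nat \<Rightarrow> nat \<Rightarrow> 'k::field poly \<Rightarrow> 'k triple \<Rightarrow> 'k triple set"
  where "dR_class n r f x = dR_coboundaries n r f +>\<^bsub>dR_cocycles n r f\<^esub> x"


section \<open>Bases, the splitting of the Hodge filtration, and its projection\<close>

text \<open>\<open>t^i y^(-j) dt\<close> as a global form: it is determined by its restriction to \<open>U\<close>.\<close>

definition omega where
  "omega n r f i j = (THE \<omega>. \<omega> \<in> carrier (H0\<Omega> n r f) \<and>
     fst \<omega> = cls_U n f (lmon (i, - int j)) \<odot>\<^bsub>\<Omega>_U n f\<^esub> d_U n f (cls_U n f (lmon (1, 0))))"

definition hfun :: "nat \<Rightarrow> 'k::field poly \<Rightarrow> nat \<Rightarrow> nat \<Rightarrow> 'k uv_poly set"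
  where "hfun n f i j = cls_UV n f (lmon (- int i, int j))"

definition hclass :: "nat \<Rightarrow> nat \<Rightarrow> 'k::field poly \<Rightarrow> nat \<Rightarrow> nat \<Rightarrow> 'k uv_poly set set"
  where "hclass n r f i j = H1O_class n r f (hfun n f i j)"

text \<open>\<open>ds / z^(n-1)\<close> denotes the form \<open>\<eta>\<close> on \<open>V\<close> with \<open>z^(n-1) \<eta> = ds\<close>.  It exists because
  \<open>n z^(n-1) dz = f\<^sub>2' ds\<close> and \<open>f\<^sub>2, f\<^sub>2'\<close> are coprime, and it is unique because
  the differentials of the smooth chart \<open>V\<close> are torsion-free.\<close>

definition eta where
  "eta n f = (THE \<eta>. \<eta> \<in> carrier (\<Omega>_V n f) \<and>
     cls_V n f (lmon (0, n - 1)) \<odot>\<^bsub>\<Omega>_V n f\<^esub> \<eta> = d_V n f (cls_V n f (lmon (1, 0))))"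

text \<open>The factor \<open>y^(j-1) / y^(n-1)\<close> is \<open>y^(j-n)\<close>, as \<open>y\<close> is invertible on \<open>U\<close>.\<close>

definition alpha_U where
  "alpha_U n f i j = cls_U n f (\<Sum>m = i + 1..degree f.
      Poly_Mapping.single (m - (i + 1), int j - int n)
        (of_int (int j * int m - int i * int n) / of_nat n * coeff f m))
    \<odot>\<^bsub>\<Omega>_U n f\<^esub> d_U n f (cls_U n f (lmon (1, 0)))"

text \<open>For \<open>m \<le> i\<close>, \<open>j < n\<close> and \<open>r \<ge> 1\<close> the natural subtractions below are exact.\<close>

definition alpha_V where
  "alpha_V n r f i j = cls_V n f (\<Sum>m = 0..i.
      Poly_Mapping.single (i + 1 + (n - j) * r - 2 - m, j - 1)
        (of_int (int i * int n - int j * int m) / of_nat n * coeff f m))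
    \<odot>\<^bsub>\<Omega>_V n f\<^esub> eta n f"

text \<open>\<open>\<tau>\<close> is the \<open>k\<close>-linear map prescribed on the basis \<open>hclass\<close> of \<open>H\<^sup>1(X\<^sub>0, O)\<close>.  Its values are
  cocycles because \<open>dh = alpha_U + alpha_V\<close> on the overlap.\<close>

definition is_splitting ::
  "nat \<Rightarrow> nat \<Rightarrow> 'k::field poly \<Rightarrow> ('k uv_poly set set \<Rightarrow> 'k triple) \<Rightarrow> bool"
  where "is_splitting n r f \<tau> \<longleftrightarrow>
    semilinear univ_ring id (H1O n r f) (dR_cocycles n r f) \<tau> \<and>
    (\<forall>i j. 1 \<le> j \<and> j \<le> n - 1 \<and> 1 \<le> i \<and> i \<le> r * j - 1 \<longrightarrow>
       \<tau> (hclass n r f i j) = (alpha_U n f i j, \<ominus>\<^bsub>\<Omega>_V n f\<^esub> alpha_V n r f i j, hfun n f i j))"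

definition hodge_sum where "hodge_sum n r f = prod_module (H0\<Omega> n r f) (H1O n r f)"

definition hodge_iso where
  "hodge_iso n r f \<tau> = (\<lambda>((\<omega>, \<omega>'), x).
     dR_class n r f (\<omega>, \<omega>', \<zero>\<^bsub>O_UV n f\<^esub>) \<oplus>\<^bsub>H1DR n r f\<^esub> dR_class n r f (\<tau> x))"

definition P1 where
  "P1 n r f \<tau> c = snd (inv_into (carrier (hodge_sum n r f)) (hodge_iso n r f \<tau>) c)"


section \<open>Divided Frobenius\<close>

text \<open>In this section \<open>p\<close> is the characteristic of the finite field \<open>k\<close>.\<close>

abbreviation frob_poly :: "nat \<Rightarrow> 'k::field poly \<Rightarrow> 'k poly"
  where "frob_poly p \<equiv> map_poly (\<lambda>c. c ^ p)"

text \<open>The \<open>k\<close>-linear relative Frobenius, from the sections over the twisted curve.\<close>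

definition Fr_U :: "nat \<Rightarrow> nat \<Rightarrow> 'k::field poly \<Rightarrow> 'k u_poly set \<Rightarrow> 'k u_poly set"
  where "Fr_U p n f = induced (\<lambda>x. cls_U n f (exp_map (\<lambda>(a, b). (p * a, int p * b)) x))"

definition Fr_V :: "nat \<Rightarrow> nat \<Rightarrow> 'k::field poly \<Rightarrow> 'k v_poly set \<Rightarrow> 'k v_poly set"
  where "Fr_V p n f = induced (\<lambda>x. cls_V n f (exp_map (\<lambda>(a, b). (p * a, p * b)) x))"

definition Fr_UV :: "nat \<Rightarrow> nat \<Rightarrow> 'k::field poly \<Rightarrow> 'k uv_poly set \<Rightarrow> 'k uv_poly set"
  where "Fr_UV p n f = induced (\<lambda>x. cls_UV n f (exp_map (\<lambda>(a, b). (int p * a, int p * b)) x))"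

definition DI_maps where
  "DI_maps p n f v fU fV h \<longleftrightarrow> (let f' = frob_poly p f in
     semilinear (O_U n f') (Fr_U p n f) (\<Omega>_U n f') (\<Omega>_U n f) fU \<and>
     semilinear (O_V n f') (Fr_V p n f) (\<Omega>_V n f') (\<Omega>_V n f) fV \<and>
     semilinear (O_UV n f') (Fr_UV p n f) (\<Omega>_UV n f') (self_module (O_UV n f)) h \<and>
     fU (d_U n f' (cls_U n f' (lmon (1, 0)))) =
       cls_U n f (lmon (p - 1, 0)) \<odot>\<^bsub>\<Omega>_U n f\<^esub> d_U n f (cls_U n f (lmon (1, 0))) \<and>
     fV (d_V n f' (cls_V n f' (lmon (1, 0)))) =
       cls_V n f (lmon (p - 1, 0) + eval_at (pderiv v) (lmon (1, 0)))
         \<odot>\<^bsub>\<Omega>_V n f\<^esub> d_V n f (cls_V n f (lmon (1, 0))) \<and>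
     h (d_UV n f' (cls_UV n f' (lmon (1, 0)))) =
       cls_UV n f (lmon (2 * int p, 0) * eval_at v (lmon (- 1, 0))))"

definition DI_map where
  "DI_map p n r f fU fV h = (\<lambda>((\<omega>, \<omega>'), X).
     dR_class n r f (fU \<omega>, fV \<omega>', h (res\<Omega>_U n (frob_poly p f) \<omega>)) \<oplus>\<^bsub>H1DR n r f\<^esub>
     induced (\<lambda>x. dR_class n r f (\<zero>\<^bsub>\<Omega>_U n f\<^esub>, \<zero>\<^bsub>\<Omega>_V n f\<^esub>, Fr_UV p n f x)) X)"

text \<open>\<open>\<Phi>\<close> is the Frobenius-semilinear map prescribed on the bases.\<close>

definition is_divided_frobenius where
  "is_divided_frobenius p n r f fU fV h \<Phi> \<longleftrightarrow> (let f' = frob_poly p f in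
     semilinear univ_ring (\<lambda>c. c ^ p) (hodge_sum n r f) (H1DR n r f) \<Phi> \<and>
     (\<forall>i j. 1 \<le> j \<and> j \<le> n - 1 \<and> int i \<le> int (r * j) - 2 \<longrightarrow>
        \<Phi> (omega n r f i j, \<zero>\<^bsub>H1O n r f\<^esub>) =
        DI_map p n r f fU fV h (omega n r f' i j, \<zero>\<^bsub>H1O n r f'\<^esub>)) \<and>
     (\<forall>i j. 1 \<le> j \<and> j \<le> n - 1 \<and> 1 \<le> i \<and> i \<le> r * j - 1 \<longrightarrow>
        \<Phi> (\<zero>\<^bsub>H0\<Omega> n r f\<^esub>, hclass n r f i j) =
        DI_map p n r f fU fV h (\<zero>\<^bsub>H0\<Omega> n r f'\<^esub>, hclass n r f' i j)))"


section \<open>Witt vectors\<close>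

definition unital_ring_hom :: "('a::comm_ring_1 \<Rightarrow> 'b::comm_ring_1) \<Rightarrow> bool"
  where "unital_ring_hom \<phi> \<longleftrightarrow>
    (\<forall>x y. \<phi> (x + y) = \<phi> x + \<phi> y) \<and> (\<forall>x y. \<phi> (x * y) = \<phi> x * \<phi> y) \<and> \<phi> 1 = 1"

text \<open>
  For a perfect field \<open>k\<close> of characteristic \<open>p > 0\<close>, \<open>W(k)\<close> is, up to unique isomorphism, the strict
  \<open>p\<close>-ring with residue ring \<open>k\<close>: \<open>p\<close> is not a zero divisor, \<open>W\<close> is separated and complete for
  the \<open>p\<close>-adic topology, and \<open>W/pW = k\<close> via \<open>\<rho>\<close>.
\<close>

definition is_witt_ring :: "nat \<Rightarrow> ('w::idom \<Rightarrow> 'k::field) \<Rightarrow> bool"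
  where "is_witt_ring p \<rho> \<longleftrightarrow>
    unital_ring_hom \<rho> \<and> surj \<rho> \<and> (\<forall>x. \<rho> x = 0 \<longleftrightarrow> of_nat p dvd x) \<and>
    (\<forall>x::'w. of_nat p * x = 0 \<longrightarrow> x = 0) \<and>
    (\<forall>a::nat \<Rightarrow> 'w. (\<forall>m. of_nat p ^ m dvd a (Suc m) - a m) \<longrightarrow>
       (\<exists>!x. \<forall>m. of_nat p ^ m dvd x - a m))"

definition is_frobenius_lift :: "nat \<Rightarrow> ('w::idom \<Rightarrow> 'k::field) \<Rightarrow> ('w \<Rightarrow> 'w) \<Rightarrow> bool"
  where "is_frobenius_lift p \<rho> \<sigma> \<longleftrightarrow> unital_ring_hom \<sigma> \<and> (\<forall>x. \<rho> (\<sigma> x) = \<rho> x ^ p)"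

text \<open>The congruence in \<open>(W/p\<^sup>2)[s]\<close> imposed on \<open>v\<close> and \<open>c\<close>, where \<open>g\<close> is the polynomial
  over \<open>W\<close> at infinity.  As \<open>p X\<close> modulo \<open>p\<^sup>2\<close> depends only on \<open>X\<close> modulo \<open>p\<close>, the lift \<open>X\<close> is
  arbitrary.\<close>

definition frobenius_lift_V ::
  "nat \<Rightarrow> nat \<Rightarrow> ('w::idom \<Rightarrow> 'k::field) \<Rightarrow> ('w \<Rightarrow> 'w) \<Rightarrow> 'w poly \<Rightarrow> 'k poly \<Rightarrow> 'k poly \<Rightarrow> bool"
  where "frobenius_lift_V p n \<rho> \<sigma> g v c \<longleftrightarrow> (let g0 = map_poly \<rho> g in
    \<exists>X. map_poly \<rho> X = v * pderiv g0 ^ p - of_nat n * c * g0 ^ p \<and>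
        of_nat (p ^ 2) dvd
          g ^ p - pcompose (map_poly \<sigma> g) (monom 1 p) - of_nat p * X)"

text \<open>Coefficients with an integer index, zero outside the range.\<close>

definition zcoeff :: "'k::zero poly \<Rightarrow> int \<Rightarrow> 'k"
  where "zcoeff F m = (if m < 0 then 0 else coeff F (nat m))"

end

theory Submission
  imports Defs
begin

text \<open>
  Let \<open>h = t\<^sup>-\<^sup>i y\<^sup>j\<close>.  The statement has two halves: \<open>P\<^sub>1 \<circ> \<Phi>\<close> takes the class of \<open>h\<close> to that of \<open>h\<^sup>p\<close>, and
  the class of \<open>h\<^sup>p\<close> has the given expansion.

  For the first half, \<open>\<Phi>\<close> sends the class of \<open>h\<close> to the de Rham class of the triple \<open>(0, 0, h\<^sup>p)\<close>; this
  is a cocycle, and independent of the representative of the class of \<open>h\<close>, because the relative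
  Frobenius has differential \<open>0\<close> (lemmas \<open>coord_ring_kd_Frobenius\<close>, \<open>induced_Fr_class\<close> and
  \<open>DI_map_function_class\<close>).  It remains to see that the splitting \<open>\<tau>\<close> decomposes the class of any
  cocycle \<open>(0, 0, g)\<close> with second component the class of \<open>g\<close>.  The function component of a triple
  induces a map from de Rham cohomology to \<open>H\<^sup>1(X\<^sub>0, O)\<close> that kills \<open>H\<^sup>0(X\<^sub>0, \<Omega>)\<close>, and composed with \<open>\<tau>\<close>
  it is the identity on the functions \<open>t\<^sup>-\<^sup>i y\<^sup>j\<close>, whose classes span \<open>H\<^sup>1(X\<^sub>0, O)\<close> (lemma
  \<open>splitting_section\<close>).  Hence the second component of a decomposition is determined.  A
  decomposition exists because \<open>(0, 0, g)\<close> and \<open>\<tau>\<close> of the class of \<open>g\<close> differ, up to a coboundary,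
  by a cocycle with function component \<open>0\<close>, which is a global differential (lemma
  \<open>hodge_iso_function_class\<close>).

  The spanning statement (lemma \<open>O_UV_span\<close>) is a reduction of monomials \<open>t\<^sup>e y\<^sup>b\<close> on the overlap:
  those with \<open>e \<ge> 0\<close> extend to \<open>U\<close>, those with \<open>b \<ge> 0\<close> and \<open>e \<le> - r b\<close> extend to \<open>V\<close>, and the relation
  \<open>y\<^sup>n = f(t)\<close> lowers exponents \<open>b \<ge> n\<close>.  Negative exponents of \<open>y\<close> are raised by the same relation,
  which can be solved for its lowest term since \<open>f(0) \<noteq> 0\<close>.

  For the second half, with \<open>p j = a n + b\<close> the relation gives \<open>h\<^sup>p = t\<^sup>-\<^sup>p\<^sup>i f(t)\<^sup>a y\<^sup>b\<close>; the monomials of this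
  function that survive in \<open>H\<^sup>1(X\<^sub>0, O)\<close> are the \<open>t\<^sup>-\<^sup>k y\<^sup>b\<close> with \<open>1 \<le> k \<le> r b - 1\<close> (lemma
  \<open>h1_class_expand\<close>).

  The coordinate rings are quotients of monoid algebras, and every restriction or Frobenius map between
  them is given on exponents.  The formal input is therefore that a map of exponents compatible with
  the relations induces a map of coordinate rings (locale \<open>exp_hom\<close>), and that an algebra map
  induces a map of Kaehler differentials (locale \<open>univ_algebra_hom\<close>).
\<close>

section \<open>Quotients of groups and modules\<close>

lemma univ_ring_simps [simp]:
  "carrier univ_ring = UNIV" "x \<otimes>\<^bsub>univ_ring\<^esub> y = x * y" "\<one>\<^bsub>univ_ring\<^esub> = 1"
  "\<zero>\<^bsub>univ_ring\<^esub> = 0" "x \<oplus>\<^bsub>univ_ring\<^esub> y = x + y"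
  by (simp_all add: univ_ring_def)

lemma cring_univ_ring: "cring univ_ring"
proof (intro cringI abelian_groupI comm_monoidI)
  fix x :: 'a show "\<exists>y\<in>carrier univ_ring. y \<oplus>\<^bsub>univ_ring\<^esub> x = \<zero>\<^bsub>univ_ring\<^esub>"
    by (rule bexI[of _ "- x"]) auto
qed (auto simp: algebra_simps)

lemma induced_eq:
  assumes "x \<in> X" "\<And>y. y \<in> X \<Longrightarrow> \<phi> y = \<phi> x"
  shows "induced \<phi> X = \<phi> x"
proof -
  have "\<phi> ` X = {\<phi> x}" using assms by blast
  then show ?thesis by (simp add: induced_def)
qed

text \<open>The additive part is kept apart from the scalars so that it covers the group of de Rham cocycles.\<close>
locale quotient_group = abelian_subgroup H G for H and G :: "('c, 'm) module" (structure)
begin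

lemma coset_eq_iff:
  assumes "x \<in> carrier G" "y \<in> carrier G"
  shows "H +> x = H +> y \<longleftrightarrow> (\<exists>h\<in>H. x = h \<oplus> y)"
proof -
  have "H +> x = H +> y \<longleftrightarrow> x \<in> H +> y"
    using assms a_rcos_self[of x] a_repr_independence'[of x y] by auto
  then show ?thesis by (auto simp: a_r_coset_def')
qed

lemma quot_module_simps:
  "carrier (quot_module G H) = a_rcosets H" "\<zero>\<^bsub>quot_module G H\<^esub> = H"
  "X \<oplus>\<^bsub>quot_module G H\<^esub> Y = X <+> Y"
  by (simp_all add: quot_module_def)

lemma coset_closed: "x \<in> carrier G \<Longrightarrow> H +> x \<in> carrier (quot_module G H)"
  by (simp add: quot_module_simps a_rcosetsI a_subset)

lemma coset_cases:
  assumes "X \<in> carrier (quot_module G H)"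
  obtains x where "x \<in> carrier G" "X = H +> x"
  using assms by (auto simp: quot_module_simps A_RCOSETS_def')

lemma coset_add:
  "x \<in> carrier G \<Longrightarrow> y \<in> carrier G \<Longrightarrow> (H +> x) \<oplus>\<^bsub>quot_module G H\<^esub> (H +> y) = H +> (x \<oplus> y)"
  by (simp add: quot_module_simps a_rcos_sum)

lemma coset_zero: "H +> \<zero> = \<zero>\<^bsub>quot_module G H\<^esub>"
  by (simp add: quot_module_simps a_rcos_const)

lemma abelian_group_quot_module: "abelian_group (quot_module G H)"
proof (rule abelian_groupI)
  fix X assume "X \<in> carrier (quot_module G H)"
  then obtain x where x: "x \<in> carrier G" "X = H +> x" by (rule coset_cases)
  show "\<exists>Y\<in>carrier (quot_module G H). Y \<oplus>\<^bsub>quot_module G H\<^esub> X = \<zero>\<^bsub>quot_module G H\<^esub>"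
    by (rule bexI[of _ "H +> (\<ominus> x)"])
      (use x in \<open>auto simp: coset_add coset_closed l_neg simp flip: coset_zero\<close>)
qed (auto elim!: coset_cases simp: coset_add coset_closed a_ac simp flip: coset_zero)

lemma abelian_group_hom_coset: "abelian_group_hom G (quot_module G H) ((+>) H)"
proof -
  interpret Q: abelian_group "quot_module G H" by (rule abelian_group_quot_module)
  show ?thesis
    by (intro abelian_group_homI abelian_group_axioms abelian_group_quot_module group_hom.intro
        a_group Q.a_group group_hom_axioms.intro homI)
      (auto simp: coset_closed coset_add)
qed

end

locale quotient_module = Module.module R M
  for R :: "('c, 'x) ring_scheme" and M :: "('c, 'm) module" +
  fixes N
  assumes submodule: "submodule N R M"
begin

sublocale Q: quotient_group N M
  by (simp add: quotient_group_def M.abelian_group_axioms abelian_subgroupI3 additive_subgroup.intro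
      submodule.axioms(1)[OF submodule])

text \<open>Scalar multiplication on a quotient is the union of the cosets \<open>N + a y\<close> over all representatives
  \<open>y\<close>; as \<open>N\<close> is stable under scalars, these cosets coincide.\<close>
lemma coset_smult:
  assumes a: "a \<in> carrier R" and x: "x \<in> carrier M"
  shows "a \<odot>\<^bsub>quot_module M N\<^esub> (N +>\<^bsub>M\<^esub> x) = N +>\<^bsub>M\<^esub> (a \<odot>\<^bsub>M\<^esub> x)"
proof -
  have "N +>\<^bsub>M\<^esub> (a \<odot>\<^bsub>M\<^esub> y) = N +>\<^bsub>M\<^esub> (a \<odot>\<^bsub>M\<^esub> x)" if y: "y \<in> N +>\<^bsub>M\<^esub> x" for y
  proof -
    obtain h where h: "h \<in> N" "y = h \<oplus>\<^bsub>M\<^esub> x" using y by (auto simp: a_r_coset_def')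
    have hc: "h \<in> carrier M" using h by simp
    have "a \<odot>\<^bsub>M\<^esub> y = a \<odot>\<^bsub>M\<^esub> h \<oplus>\<^bsub>M\<^esub> a \<odot>\<^bsub>M\<^esub> x" using a x h hc by (simp add: smult_r_distr)
    moreover have "a \<odot>\<^bsub>M\<^esub> h \<in> N" using submoduleE(4)[OF submodule a h(1)] .
    ultimately show ?thesis
      by (subst Q.coset_eq_iff) (use a x h hc in auto)
  qed
  moreover have "x \<in> N +>\<^bsub>M\<^esub> x" using x by (rule Q.a_rcos_self)
  ultimately have "(\<Union>y\<in>N +>\<^bsub>M\<^esub> x. N +>\<^bsub>M\<^esub> (a \<odot>\<^bsub>M\<^esub> y)) = N +>\<^bsub>M\<^esub> (a \<odot>\<^bsub>M\<^esub> x)"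
    by blast
  then show ?thesis by (simp add: quot_module_def)
qed

lemma module_quot_module: "Module.module R (quot_module M N)"
proof -
  note [simp] = coset_smult Q.coset_add Q.coset_closed
  show ?thesis
    by (rule moduleI[OF R.is_cring Q.abelian_group_quot_module])
      (erule Q.coset_cases | simp add: smult_l_distr smult_r_distr smult_assoc1)+
qed

end

section \<open>Kaehler differentials and their functoriality\<close>

lemma free_module_simps [simp]:
  "\<phi> \<in> carrier (free_module A) \<longleftrightarrow> (\<forall>x. \<phi> x \<in> carrier A) \<and>
    (\<forall>x. x \<notin> carrier A \<longrightarrow> \<phi> x = \<zero>\<^bsub>A\<^esub>) \<and> finite {x. \<phi> x \<noteq> \<zero>\<^bsub>A\<^esub>}"
  "\<zero>\<^bsub>free_module A\<^esub> = (\<lambda>x. \<zero>\<^bsub>A\<^esub>)"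
  "\<phi> \<oplus>\<^bsub>free_module A\<^esub> \<psi> = (\<lambda>x. \<phi> x \<oplus>\<^bsub>A\<^esub> \<psi> x)"
  "a \<odot>\<^bsub>free_module A\<^esub> \<phi> = (\<lambda>x. a \<otimes>\<^bsub>A\<^esub> \<phi> x)"
  by (simp_all add: free_module_def)

lemma module_free_module:
  fixes A :: "('k, 'a) module"
  assumes "cring A" shows "Module.module A (free_module A)"
proof -
  interpret A: cring A by fact
  have fin_add: "finite {x. \<phi> x \<oplus>\<^bsub>A\<^esub> \<psi> x \<noteq> \<zero>\<^bsub>A\<^esub>}"
    if "finite {x. \<phi> x \<noteq> \<zero>\<^bsub>A\<^esub>}" "finite {x. \<psi> x \<noteq> \<zero>\<^bsub>A\<^esub>}" for \<phi> \<psi> :: "'a \<Rightarrow> 'a"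
    by (rule finite_subset[of _ "{x. \<phi> x \<noteq> \<zero>\<^bsub>A\<^esub>} \<union> {x. \<psi> x \<noteq> \<zero>\<^bsub>A\<^esub>}"]) (use that in auto)
  have fin_smult: "finite {x. a \<otimes>\<^bsub>A\<^esub> \<phi> x \<noteq> \<zero>\<^bsub>A\<^esub>}"
    if "finite {x. \<phi> x \<noteq> \<zero>\<^bsub>A\<^esub>}" "a \<in> carrier A" for a and \<phi> :: "'a \<Rightarrow> 'a"
    by (rule finite_subset[of _ "{x. \<phi> x \<noteq> \<zero>\<^bsub>A\<^esub>}"]) (use that in auto)
  have fin_inv: "finite {x. \<ominus>\<^bsub>A\<^esub> \<phi> x \<noteq> \<zero>\<^bsub>A\<^esub>}"
    if "finite {x. \<phi> x \<noteq> \<zero>\<^bsub>A\<^esub>}" for \<phi> :: "'a \<Rightarrow> 'a"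
    by (rule finite_subset[of _ "{x. \<phi> x \<noteq> \<zero>\<^bsub>A\<^esub>}"]) (use that in auto)
  have "abelian_group (free_module A)"
  proof (rule abelian_groupI)
    fix \<phi> assume "\<phi> \<in> carrier (free_module A)"
    then show "\<exists>\<psi>\<in>carrier (free_module A). \<psi> \<oplus>\<^bsub>free_module A\<^esub> \<phi> = \<zero>\<^bsub>free_module A\<^esub>"
      by (intro bexI[of _ "\<lambda>x. \<ominus>\<^bsub>A\<^esub> \<phi> x"]) (auto simp: A.l_neg fin_inv)
  qed (auto simp: fin_add A.a_ac)
  then show ?thesis
    by (intro moduleI assms)
      (auto simp: A.l_distr A.r_distr A.m_assoc fin_smult)
qed

text \<open>Algebras over the whole of a type.  The ring structure comes first so that its facts take
  precedence over those of the base ring, which carry the qualifier \<open>U\<close>.\<close>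
locale univ_algebra = A?: cring A + U: algebra univ_ring A for A :: "('k::comm_ring_1, 'a) module" (structure)
begin

abbreviation "const c \<equiv> c \<odot> \<one>"

lemma const_closed [simp]: "const c \<in> carrier A" by simp

sublocale F: Module.module A "free_module A"
  using A.is_cring by (rule module_free_module)

lemma free_gen_closed: "x \<in> carrier A \<Longrightarrow> free_gen A x \<in> carrier (free_module A)"
  by (auto simp: free_gen_def)

lemma kaehler_gens_closed: "kaehler_gens A \<subseteq> carrier (free_module A)"
proof -
  note [simp del] = free_module_simps
  show ?thesis
    unfolding kaehler_gens_def Let_def
    by (auto intro!: F.M.minus_closed F.M.a_closed F.smult_closed free_gen_closed)
qed

lemma submodule_kaehler_rels: "submodule (kaehler_rels A) A (free_module A)"
proof -
  note [simp del] = free_module_simps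
  let ?S = "{N. submodule N A (free_module A) \<and> kaehler_gens A \<subseteq> N}"
  have "carrier (free_module A) \<in> ?S"
    using kaehler_gens_closed F.carrier_is_submodule by auto
  then have "\<Inter>?S \<subseteq> carrier (free_module A)" by blast
  moreover have "\<zero>\<^bsub>free_module A\<^esub> \<in> N" if "N \<in> ?S" for N
    using that subgroup.one_closed[OF submodule.axioms(1), of N A "free_module A"] by simp
  ultimately show ?thesis
    unfolding kaehler_rels_def
    by (intro F.submoduleI) (auto intro: F.submoduleE)
qed

lemma kaehler_gens_rels: "kaehler_gens A \<subseteq> kaehler_rels A"
  by (auto simp: kaehler_rels_def)

sublocale KR: quotient_module A "free_module A" "kaehler_rels A"
  by (simp add: quotient_module_def quotient_module_axioms_def F.module_axioms submodule_kaehler_rels)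

sublocale K: Module.module A "kaehler A"
  unfolding kaehler_def by (rule KR.module_quot_module)

lemma kd_closed [simp]: "x \<in> carrier A \<Longrightarrow> kd A x \<in> carrier (kaehler A)"
  unfolding kd_def kaehler_def by (intro KR.Q.coset_closed free_gen_closed)

lemma coset_eqI:
  assumes "\<phi> \<ominus>\<^bsub>free_module A\<^esub> \<psi> \<in> kaehler_gens A"
    "\<phi> \<in> carrier (free_module A)" "\<psi> \<in> carrier (free_module A)"
  shows "kaehler_rels A +>\<^bsub>free_module A\<^esub> \<phi> = kaehler_rels A +>\<^bsub>free_module A\<^esub> \<psi>"
proof -
  note [simp del] = free_module_simps
  have "\<phi> = (\<phi> \<ominus>\<^bsub>free_module A\<^esub> \<psi>) \<oplus>\<^bsub>free_module A\<^esub> \<psi>"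
    using assms(2,3) by (simp add: a_minus_def F.M.a_assoc F.M.l_neg)
  then show ?thesis
    using assms kaehler_gens_rels by (subst KR.Q.coset_eq_iff) auto
qed

lemma kd_add:
  assumes "x \<in> carrier A" "y \<in> carrier A"
  shows "kd A (x \<oplus> y) = kd A x \<oplus>\<^bsub>kaehler A\<^esub> kd A y"
proof -
  note [simp del] = free_module_simps
  note [simp] = free_gen_closed
  have "kd A x \<oplus>\<^bsub>kaehler A\<^esub> kd A y =
    kaehler_rels A +>\<^bsub>free_module A\<^esub> (free_gen A x \<oplus>\<^bsub>free_module A\<^esub> free_gen A y)"
    using assms unfolding kd_def kaehler_def by (simp add: KR.Q.coset_add)
  also have "\<dots> = kd A (x \<oplus> y)"
    unfolding kd_def
    by (rule coset_eqI[symmetric]) (use assms in \<open>auto simp: kaehler_gens_def Let_def\<close>)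
  finally show ?thesis ..
qed

lemma kd_mult:
  assumes "x \<in> carrier A" "y \<in> carrier A"
  shows "kd A (x \<otimes> y) = x \<odot>\<^bsub>kaehler A\<^esub> kd A y \<oplus>\<^bsub>kaehler A\<^esub> y \<odot>\<^bsub>kaehler A\<^esub> kd A x"
proof -
  note [simp del] = free_module_simps
  note [simp] = free_gen_closed
  have "x \<odot>\<^bsub>kaehler A\<^esub> kd A y \<oplus>\<^bsub>kaehler A\<^esub> y \<odot>\<^bsub>kaehler A\<^esub> kd A x =
    kaehler_rels A +>\<^bsub>free_module A\<^esub> (x \<odot>\<^bsub>free_module A\<^esub> free_gen A y \<oplus>\<^bsub>free_module A\<^esub>
      y \<odot>\<^bsub>free_module A\<^esub> free_gen A x)"
    using assms unfolding kd_def kaehler_def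
    by (simp add: KR.Q.coset_add KR.coset_smult)
  also have "\<dots> = kd A (x \<otimes> y)"
    unfolding kd_def
    by (rule coset_eqI[symmetric])
      (use assms in \<open>auto simp: kaehler_gens_def Let_def\<close>)
  finally show ?thesis ..
qed

lemma kd_const: "kd A (const c) = \<zero>\<^bsub>kaehler A\<^esub>"
proof -
  have "free_gen A (const c) \<in> kaehler_rels A"
    using kaehler_gens_rels unfolding kaehler_gens_def Let_def by blast
  then show ?thesis
    unfolding kd_def kaehler_def by (simp add: KR.Q.a_rcos_const KR.Q.quot_module_simps)
qed

lemma const_mult: "x \<in> carrier A \<Longrightarrow> c \<odot> x = const c \<otimes> x"
  by (simp add: U.smult_assoc2)

lemma kd_smult:
  assumes "x \<in> carrier A"
  shows "kd A (c \<odot> x) = const c \<odot>\<^bsub>kaehler A\<^esub> kd A x"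
proof -
  have "kd A (c \<odot> x) = kd A (const c \<otimes> x)" using const_mult[OF assms] by simp
  also have "\<dots> = const c \<odot>\<^bsub>kaehler A\<^esub> kd A x \<oplus>\<^bsub>kaehler A\<^esub> x \<odot>\<^bsub>kaehler A\<^esub> kd A (const c)"
    using assms by (intro kd_mult) auto
  finally show ?thesis using assms by (simp add: kd_const)
qed

lemma kd_power:
  assumes x: "x \<in> carrier A"
  shows "kd A (x [^] Suc m) =
    (const (of_nat (Suc m)) \<otimes> x [^] m) \<odot>\<^bsub>kaehler A\<^esub> kd A x"
proof (induction m)
  case 0
  then show ?case using x U.smult_one[of \<one>] by simp
next
  case (Suc m)
  let ?c = "\<lambda>m. const (of_nat m)"
  have c: "?c (Suc (Suc m)) = \<one> \<oplus> ?c (Suc m)"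
  proof -
    have "?c (Suc (Suc m)) = (1 \<oplus>\<^bsub>univ_ring\<^esub> of_nat (Suc m)) \<odot> \<one>" by simp
    also have "\<dots> = \<one> \<oplus> ?c (Suc m)"
      by (subst U.smult_l_distr) (use U.smult_one[of \<one>] in auto)
    finally show ?thesis .
  qed
  have "kd A (x [^] Suc (Suc m)) = kd A (x [^] Suc m \<otimes> x)" by simp
  also have "\<dots> = x [^] Suc m \<odot>\<^bsub>kaehler A\<^esub> kd A x \<oplus>\<^bsub>kaehler A\<^esub> x \<odot>\<^bsub>kaehler A\<^esub> kd A (x [^] Suc m)"
    using x by (intro kd_mult) auto
  also have "\<dots> = (x [^] Suc m \<oplus> x \<otimes> (?c (Suc m) \<otimes> x [^] m)) \<odot>\<^bsub>kaehler A\<^esub> kd A x"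
    using x unfolding Suc by (simp add: K.smult_l_distr K.smult_assoc1 del: of_nat_Suc)
  also have "x [^] Suc m \<oplus> x \<otimes> (?c (Suc m) \<otimes> x [^] m) = ?c (Suc (Suc m)) \<otimes> x [^] Suc m"
  proof -
    have "x \<otimes> (?c (Suc m) \<otimes> x [^] m) = ?c (Suc m) \<otimes> x [^] Suc m"
      using x by (simp add: A.m_ac del: of_nat_Suc)
    then show ?thesis
      unfolding c using x by (simp add: A.l_distr del: of_nat_Suc)
  qed
  finally show ?case .
qed

text \<open>In characteristic \<open>p\<close> the factor \<open>p\<close> in \<open>d(x\<^sup>p) = p x\<^sup>p\<^sup>-\<^sup>1 dx\<close> vanishes.  This is the reason why the
  pullback of a function under Frobenius has differential \<open>0\<close>.\<close>
lemma kd_char_power: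
  assumes x: "x \<in> carrier A" and p: "of_nat p = (0::'k)" "p > 0"
  shows "kd A (x [^] p) = \<zero>\<^bsub>kaehler A\<^esub>"
proof -
  obtain m where m: "p = Suc m" using p by (cases p) auto
  have "const (of_nat p) = \<zero>" using p U.smult_l_null[of \<one>] by simp
  then show ?thesis using kd_power[OF x, of m] x unfolding m by simp
qed

sublocale D: abelian_group_hom A "kaehler A" "kd A"
  by (intro abelian_group_homI A.abelian_group_axioms K.M.abelian_group_axioms group_hom.intro
      A.a_group K.M.a_group group_hom_axioms.intro homI) (auto simp: kd_add)

end

text \<open>Compatibility with the structure maps of the algebras is what makes the induced map on differentials kill
  the relations \<open>d(c \<cdot> 1) = 0\<close>.\<close>
locale univ_algebra_hom = A?: univ_algebra A + B: univ_algebra B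
  for A :: "('k::comm_ring_1, 'a) module" (structure) and B :: "('k, 'b) module"
    and \<rho> :: "'a \<Rightarrow> 'b" +
  assumes ring_hom: "\<rho> \<in> ring_hom A B"
    and hom_const: "\<rho> (c \<odot> \<one>) = B.const c"
begin

lemma hom_simps [simp]:
  "x \<in> carrier A \<Longrightarrow> \<rho> x \<in> carrier B"
  "x \<in> carrier A \<Longrightarrow> y \<in> carrier A \<Longrightarrow> \<rho> (x \<oplus> y) = \<rho> x \<oplus>\<^bsub>B\<^esub> \<rho> y"
  "x \<in> carrier A \<Longrightarrow> y \<in> carrier A \<Longrightarrow> \<rho> (x \<otimes> y) = \<rho> x \<otimes>\<^bsub>B\<^esub> \<rho> y"
  "\<rho> \<one> = \<one>\<^bsub>B\<^esub>"
  using ring_hom by (auto simp: ring_hom_def)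

sublocale H: abelian_group_hom A B \<rho>
  by (intro abelian_group_homI A.abelian_group_axioms B.A.abelian_group_axioms group_hom.intro
      A.A.a_group B.A.a_group group_hom_axioms.intro homI) auto

lemma hom_smult: "x \<in> carrier A \<Longrightarrow> \<rho> (c \<odot> x) = c \<odot>\<^bsub>B\<^esub> \<rho> x"
  by (subst A.const_mult, assumption, subst B.const_mult) (auto simp: hom_const)

text \<open>The map on Kaehler differentials is constructed in two steps: the formula \<open>a dx \<mapsto> \<rho>(a) d\<rho>(x)\<close> is first
  read on the free module, where it is visibly semilinear; its kernel is then a submodule containing
  the defining relations, so that it passes to the quotient.\<close>

definition lift_free :: "('a \<Rightarrow> 'a) \<Rightarrow> ('b \<Rightarrow> 'b) set"
  where "lift_free \<phi> = (\<Oplus>\<^bsub>kaehler B\<^esub>x\<in>{x. \<phi> x \<noteq> \<zero>}. \<rho> (\<phi> x) \<odot>\<^bsub>kaehler B\<^esub> kd B (\<rho> x))"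

text \<open>The supports of \<open>\<phi>\<close>, \<open>\<psi>\<close> and \<open>\<phi> + \<psi>\<close> differ; summing over a common finite superset
  makes additivity a termwise statement.\<close>
lemma lift_free_superset:
  assumes \<phi>: "\<phi> \<in> carrier (free_module A)" and T: "finite T" "T \<subseteq> carrier A" "{x. \<phi> x \<noteq> \<zero>} \<subseteq> T"
  shows "lift_free \<phi> = (\<Oplus>\<^bsub>kaehler B\<^esub>x\<in>T. \<rho> (\<phi> x) \<odot>\<^bsub>kaehler B\<^esub> kd B (\<rho> x))"
  unfolding lift_free_def
proof (rule B.K.M.add.finprod_mono_neutral_cong_left[OF T(1,3)], goal_cases)
  case (1 x)
  then have "\<phi> x = \<zero>" "x \<in> carrier A" using T by auto
  then show ?case by simp
next
  case 2
  then show ?case using \<phi> T by (auto simp: subset_eq)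
next
  case 3
  show ?case using \<phi> T by (auto intro!: B.K.smult_closed B.kd_closed hom_simps(1))
qed

lemma lift_free_closed: "\<phi> \<in> carrier (free_module A) \<Longrightarrow> lift_free \<phi> \<in> carrier (kaehler B)"
  unfolding lift_free_def
  by (rule B.K.M.finsum_closed) (auto intro!: B.K.smult_closed B.kd_closed hom_simps(1))

lemma lift_free_add:
  assumes "\<phi> \<in> carrier (free_module A)" "\<psi> \<in> carrier (free_module A)"
  shows "lift_free (\<phi> \<oplus>\<^bsub>free_module A\<^esub> \<psi>) = lift_free \<phi> \<oplus>\<^bsub>kaehler B\<^esub> lift_free \<psi>"
proof -
  let ?T = "{x. \<phi> x \<noteq> \<zero>} \<union> {x. \<psi> x \<noteq> \<zero>}"
  have T: "finite ?T" "?T \<subseteq> carrier A" using assms by auto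
  have s: "\<phi> \<oplus>\<^bsub>free_module A\<^esub> \<psi> \<in> carrier (free_module A)"
    using assms A.F.M.a_closed by blast
  have c: "\<rho> (\<phi> x) \<in> carrier B" "\<rho> (\<psi> x) \<in> carrier B" for x using assms by auto
  have "lift_free (\<phi> \<oplus>\<^bsub>free_module A\<^esub> \<psi>) =
    (\<Oplus>\<^bsub>kaehler B\<^esub>x\<in>?T. \<rho> (\<phi> x \<oplus> \<psi> x) \<odot>\<^bsub>kaehler B\<^esub> kd B (\<rho> x))"
    by (subst lift_free_superset[OF s T]) (use assms in \<open>auto simp del: free_module_simps(2)\<close>)
  also have "\<dots> = (\<Oplus>\<^bsub>kaehler B\<^esub>x\<in>?T. \<rho> (\<phi> x) \<odot>\<^bsub>kaehler B\<^esub> kd B (\<rho> x) \<oplus>\<^bsub>kaehler B\<^esub>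
      \<rho> (\<psi> x) \<odot>\<^bsub>kaehler B\<^esub> kd B (\<rho> x))"
  proof (rule B.K.M.finsum_cong')
    fix x assume "x \<in> ?T"
    then have "x \<in> carrier A" using T by blast
    then show "\<rho> (\<phi> x \<oplus> \<psi> x) \<odot>\<^bsub>kaehler B\<^esub> kd B (\<rho> x) = \<rho> (\<phi> x) \<odot>\<^bsub>kaehler B\<^esub> kd B (\<rho> x) \<oplus>\<^bsub>kaehler B\<^esub>
      \<rho> (\<psi> x) \<odot>\<^bsub>kaehler B\<^esub> kd B (\<rho> x)"
      using assms by (simp add: B.K.smult_l_distr)
  qed (use c T in \<open>auto simp: subset_eq\<close>)
  also have "\<dots> = lift_free \<phi> \<oplus>\<^bsub>kaehler B\<^esub> lift_free \<psi>"
  proof -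
    have "lift_free \<phi> = (\<Oplus>\<^bsub>kaehler B\<^esub>x\<in>?T. \<rho> (\<phi> x) \<odot>\<^bsub>kaehler B\<^esub> kd B (\<rho> x))"
      "lift_free \<psi> = (\<Oplus>\<^bsub>kaehler B\<^esub>x\<in>?T. \<rho> (\<psi> x) \<odot>\<^bsub>kaehler B\<^esub> kd B (\<rho> x))"
      by (rule lift_free_superset[OF _ T], use assms in blast, blast)+
    moreover have "\<rho> x \<in> carrier B" if "x \<in> ?T" for x
      using that T by (intro hom_simps(1)) blast
    ultimately show ?thesis
      using c by (simp only:, intro B.K.M.finsum_addf funcsetI B.K.smult_closed B.kd_closed; blast)
  qed
  finally show ?thesis .
qed

lemma lift_free_smult:
  assumes "a \<in> carrier A" "\<phi> \<in> carrier (free_module A)"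
  shows "lift_free (a \<odot>\<^bsub>free_module A\<^esub> \<phi>) = \<rho> a \<odot>\<^bsub>kaehler B\<^esub> lift_free \<phi>"
proof -
  let ?T = "{x. \<phi> x \<noteq> \<zero>}"
  have T: "finite ?T" "?T \<subseteq> carrier A" using assms by auto
  have s: "a \<odot>\<^bsub>free_module A\<^esub> \<phi> \<in> carrier (free_module A)"
    using assms A.F.smult_closed by blast
  have c: "\<rho> (\<phi> x) \<in> carrier B" for x using assms by auto
  have "lift_free (a \<odot>\<^bsub>free_module A\<^esub> \<phi>) =
    (\<Oplus>\<^bsub>kaehler B\<^esub>x\<in>?T. \<rho> (a \<otimes> \<phi> x) \<odot>\<^bsub>kaehler B\<^esub> kd B (\<rho> x))"
    by (subst lift_free_superset[OF s T]) (use assms in auto)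
  also have "\<dots> = (\<Oplus>\<^bsub>kaehler B\<^esub>x\<in>?T. \<rho> a \<odot>\<^bsub>kaehler B\<^esub> (\<rho> (\<phi> x) \<odot>\<^bsub>kaehler B\<^esub> kd B (\<rho> x)))"
  proof (rule B.K.M.finsum_cong')
    fix x assume "x \<in> ?T"
    then have "x \<in> carrier A" using T by blast
    then show "\<rho> (a \<otimes> \<phi> x) \<odot>\<^bsub>kaehler B\<^esub> kd B (\<rho> x) =
      \<rho> a \<odot>\<^bsub>kaehler B\<^esub> (\<rho> (\<phi> x) \<odot>\<^bsub>kaehler B\<^esub> kd B (\<rho> x))"
      using assms by (simp add: B.K.smult_assoc1)
  qed (use assms c T in \<open>auto simp: subset_eq\<close>)
  also have "\<dots> = \<rho> a \<odot>\<^bsub>kaehler B\<^esub> lift_free \<phi>"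
    unfolding lift_free_def
    by (rule B.K.finsum_smult_ldistr[symmetric])
      (use assms c T in \<open>auto intro!: B.K.smult_closed B.kd_closed\<close>)
  finally show ?thesis .
qed

lemma lift_free_gen:
  assumes "x \<in> carrier A"
  shows "lift_free (free_gen A x) = kd B (\<rho> x)"
proof -
  have "lift_free (free_gen A x) = (\<Oplus>\<^bsub>kaehler B\<^esub>y\<in>{x}. \<rho> (free_gen A x y) \<odot>\<^bsub>kaehler B\<^esub> kd B (\<rho> y))"
    by (rule lift_free_superset[OF A.free_gen_closed]) (use assms in \<open>auto simp: free_gen_def\<close>)
  then show ?thesis using assms by (simp add: free_gen_def)
qed

lemma lift_free_hom: "abelian_group_hom (free_module A) (kaehler B) lift_free"
  by (intro abelian_group_homI A.F.M.abelian_group_axioms B.K.M.abelian_group_axioms group_hom.intro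
      A.F.M.a_group B.K.M.a_group group_hom_axioms.intro homI)
   (simp_all add: lift_free_add lift_free_closed del: free_module_simps)

interpretation L: abelian_group_hom "free_module A" "kaehler B" lift_free by (rule lift_free_hom)

text \<open>The kernel is a submodule, and \<open>kaehler_rels\<close> is the least submodule containing the three families of
  generators, so it suffices that \<open>d \<circ> \<rho>\<close> is a derivation vanishing on constants.\<close>
lemma kaehler_rels_kernel: "kaehler_rels A \<subseteq> {\<phi> \<in> carrier (free_module A). lift_free \<phi> = \<zero>\<^bsub>kaehler B\<^esub>}"
proof -
  note [simp del] = free_module_simps
  note [simp] = A.free_gen_closed lift_free_gen lift_free_smult
  let ?N = "{\<phi> \<in> carrier (free_module A). lift_free \<phi> = \<zero>\<^bsub>kaehler B\<^esub>}"
  have "submodule ?N A (free_module A)"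
    by (rule A.F.submoduleI) auto
  moreover have "lift_free \<phi> = \<zero>\<^bsub>kaehler B\<^esub>" if "\<phi> \<in> kaehler_gens A" for \<phi>
    using that unfolding kaehler_gens_def Let_def
    by (auto simp: a_minus_def B.kd_add B.kd_mult hom_const B.kd_const B.K.M.r_neg)
  ultimately show ?thesis
    using A.kaehler_gens_closed unfolding kaehler_rels_def by blast
qed

lemma kaehler_map_coset:
  assumes \<phi>: "\<phi> \<in> carrier (free_module A)"
  shows "kaehler_map A B \<rho> (kaehler_rels A +>\<^bsub>free_module A\<^esub> \<phi>) = lift_free \<phi>"
proof -
  note [simp del] = free_module_simps
  have "induced lift_free (kaehler_rels A +>\<^bsub>free_module A\<^esub> \<phi>) = lift_free \<phi>"
  proof (rule induced_eq)
    show "\<phi> \<in> kaehler_rels A +>\<^bsub>free_module A\<^esub> \<phi>" using \<phi> by (rule A.KR.Q.a_rcos_self)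
    fix \<psi> assume "\<psi> \<in> kaehler_rels A +>\<^bsub>free_module A\<^esub> \<phi>"
    then obtain h where h: "h \<in> kaehler_rels A" "\<psi> = h \<oplus>\<^bsub>free_module A\<^esub> \<phi>"
      by (auto simp: a_r_coset_def')
    then show "lift_free \<psi> = lift_free \<phi>"
      using kaehler_rels_kernel \<phi> by auto
  qed
  then show ?thesis unfolding kaehler_map_def lift_free_def[abs_def] .
qed

sublocale KM: abelian_group_hom "kaehler A" "kaehler B" "kaehler_map A B \<rho>"
proof -
  note [simp del] = free_module_simps
  note [simp] = A.KR.Q.coset_add kaehler_map_coset
  have "group_hom (add_monoid (kaehler A)) (add_monoid (kaehler B)) (kaehler_map A B \<rho>)"
    by (intro group_hom.intro A.K.M.a_group B.K.M.a_group group_hom_axioms.intro homI)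
      (auto simp: kaehler_def[of A] elim!: A.KR.Q.coset_cases)
  then show "abelian_group_hom (kaehler A) (kaehler B) (kaehler_map A B \<rho>)"
    by (intro abelian_group_homI A.K.M.abelian_group_axioms B.K.M.abelian_group_axioms)
qed

lemma kaehler_map_kd: "x \<in> carrier A \<Longrightarrow> kaehler_map A B \<rho> (kd A x) = kd B (\<rho> x)"
  unfolding kd_def[of A] by (simp add: kaehler_map_coset A.free_gen_closed lift_free_gen del: free_module_simps)

end

section \<open>Coordinate rings as quotients of monoid algebras\<close>

lemma single_zero_mult:
  "Poly_Mapping.single 0 (a * b) = Poly_Mapping.single 0 a * (Poly_Mapping.single 0 b :: 'm::comm_monoid_add \<Rightarrow>\<^sub>0 'k::comm_ring_1)"
  by (simp add: mult_single)

lemma genideal_univ_ring: "Idl\<^bsub>univ_ring\<^esub> {g} = {x. g dvd x}"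
proof -
  interpret cring "univ_ring :: 'a ring" by (rule cring_univ_ring)
  have "Idl\<^bsub>univ_ring\<^esub> {g} = PIdl\<^bsub>univ_ring\<^esub> g"
    by (rule cgenideal_eq_genideal[symmetric]) simp
  then show ?thesis by (auto simp: cgenideal_def dvd_def mult.commute)
qed

lemma mem_cls_iff: "y \<in> cls g x \<longleftrightarrow> g dvd y - x"
  unfolding cls_def genideal_univ_ring a_r_coset_def'
  by (auto intro: exI[of _ "y - x"])

lemma cls_eq_iff: "cls g x = cls g y \<longleftrightarrow> g dvd x - y"
proof
  assume "cls g x = cls g y"
  then show "g dvd x - y" by (metis mem_cls_iff cancel_comm_monoid_add_class.diff_cancel dvd_0_right)
next
  assume "g dvd x - y"
  then have "g dvd z - x \<longleftrightarrow> g dvd z - y" for z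
    using dvd_add_left_iff[OF \<open>g dvd x - y\<close>, of "z - x"] by simp
  then show "cls g x = cls g y" by (auto simp: mem_cls_iff)
qed

lemma coord_ring_simps:
  "carrier (coord_ring g) = range (cls g)"
  "cls g x \<oplus>\<^bsub>coord_ring g\<^esub> cls g y = cls g (x + y)"
  "cls g x \<otimes>\<^bsub>coord_ring g\<^esub> cls g y = cls g (x * y)"
  "\<one>\<^bsub>coord_ring g\<^esub> = cls g 1"
  "\<zero>\<^bsub>coord_ring g\<^esub> = cls g 0"
  "c \<odot>\<^bsub>coord_ring g\<^esub> cls g x = cls g (Poly_Mapping.single 0 c * x)"
proof -
  interpret R: cring "univ_ring :: ('a \<Rightarrow>\<^sub>0 'b) ring" by (rule cring_univ_ring)
  let ?I = "Idl\<^bsub>univ_ring\<^esub> {g}"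
  interpret I: ideal ?I "univ_ring :: ('a \<Rightarrow>\<^sub>0 'b) ring" by (rule R.genideal_ideal) simp
  have m: "cls g x \<otimes>\<^bsub>univ_ring Quot ?I\<^esub> cls g y = cls g (x * y)" for x y
    unfolding cls_def FactRing_def by (simp add: I.rcoset_mult_add)
  show "carrier (coord_ring g) = range (cls g)"
    by (auto simp: coord_ring_def Let_def FactRing_def A_RCOSETS_def' cls_def)
  show "cls g x \<oplus>\<^bsub>coord_ring g\<^esub> cls g y = cls g (x + y)"
    by (simp add: coord_ring_def Let_def FactRing_def cls_def I.a_rcos_sum)
  show "cls g x \<otimes>\<^bsub>coord_ring g\<^esub> cls g y = cls g (x * y)"
    by (simp add: coord_ring_def Let_def m)
  show "\<one>\<^bsub>coord_ring g\<^esub> = cls g 1"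
    by (simp add: coord_ring_def Let_def FactRing_def cls_def)
  show "\<zero>\<^bsub>coord_ring g\<^esub> = cls g 0"
    using I.a_rcos_const[of 0] I.zero_closed by (simp add: coord_ring_def Let_def FactRing_def cls_def)
  show "c \<odot>\<^bsub>coord_ring g\<^esub> cls g x = cls g (Poly_Mapping.single 0 c * x)"
    by (simp add: coord_ring_def Let_def m)
qed

lemma cls_closed [simp]: "cls g x \<in> carrier (coord_ring g)"
  by (simp add: coord_ring_simps)

lemma coord_ring_cases:
  assumes "X \<in> carrier (coord_ring g)" obtains x where "X = cls g x"
  using assms by (auto simp: coord_ring_simps)

lemma cring_coord_ring: "cring (coord_ring g)"
proof (intro cringI abelian_groupI comm_monoidI)
  fix X assume "X \<in> carrier (coord_ring g)"
  then obtain x where X: "X = cls g x" by (rule coord_ring_cases)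
  show "\<exists>Y\<in>carrier (coord_ring g). Y \<oplus>\<^bsub>coord_ring g\<^esub> X = \<zero>\<^bsub>coord_ring g\<^esub>"
    by (rule bexI[of _ "cls g (- x)"]) (simp_all add: X coord_ring_simps)
qed (auto simp: coord_ring_simps algebra_simps)

lemma univ_algebra_coord_ring: "univ_algebra (coord_ring g)"
  by (intro univ_algebra.intro algebraI cring_coord_ring cring_univ_ring)
    (auto simp: coord_ring_simps algebra_simps single_add single_zero_mult)

lemma cls_power: "cls g x [^]\<^bsub>coord_ring g\<^esub> (m::nat) = cls g (x ^ m)"
  by (induction m) (simp_all add: nat_pow_def coord_ring_simps mult.commute)

section \<open>Maps given on exponents\<close>

lemma monoid_algebra_induct [case_names single add]:
  fixes x :: "'m \<Rightarrow>\<^sub>0 'k::comm_monoid_add"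
  assumes "\<And>m c. P (Poly_Mapping.single m c)" "\<And>x y. P x \<Longrightarrow> P y \<Longrightarrow> P (x + y)"
  shows "P x"
proof (induction x rule: update_induct)
  case const
  show ?case using assms(1)[of _ 0] by simp
next
  case (update f a b)
  have "Poly_Mapping.update a b f = f + Poly_Mapping.single a b"
    using update(1) by (intro poly_mapping_eqI)
      (auto simp: lookup_update lookup_add lookup_single when_def in_keys_iff)
  then show ?case using assms update by simp
qed

lemma exp_map_superset:
  assumes "finite T" "Poly_Mapping.keys x \<subseteq> T"
  shows "exp_map h x = (\<Sum>m\<in>T. Poly_Mapping.single (h m) (Poly_Mapping.lookup x m))"
  unfolding exp_map_def using assms by (intro sum.mono_neutral_left) (auto simp: in_keys_iff)

lemma exp_map_single [simp]: "exp_map h (Poly_Mapping.single m c) = Poly_Mapping.single (h m) c"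
  by (subst exp_map_superset[of "{m}"]) (auto simp: lookup_single)

lemma exp_map_add: "exp_map h (x + y) = exp_map h x + exp_map h y"
proof -
  let ?T = "Poly_Mapping.keys x \<union> Poly_Mapping.keys y"
  have "Poly_Mapping.keys (x + y) \<subseteq> ?T" by (rule Poly_Mapping.keys_add)
  then show ?thesis
    by (subst (1 2 3) exp_map_superset[of ?T]) (auto simp: lookup_add single_add sum.distrib)
qed

lemma exp_map_zero [simp]: "exp_map h 0 = 0"
  by (simp add: exp_map_def)

lemma exp_map_uminus: "exp_map h (- x) = - exp_map h x"
  by (metis exp_map_add exp_map_zero add.right_inverse minus_unique)

lemma exp_map_diff: "exp_map h (x - y) = exp_map h x - exp_map h y"
  using exp_map_add[of h x "- y"] by (simp add: exp_map_uminus)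

lemma exp_map_comp: "exp_map h (exp_map k x) = exp_map (h \<circ> k) x"
  by (induction x rule: monoid_algebra_induct) (simp_all add: exp_map_add)

lemma exp_map_mult:
  assumes h: "\<And>a b. h (a + b) = h a + h b"
  shows "exp_map h (x * y) = exp_map h x * exp_map h y"
proof (induction x rule: monoid_algebra_induct)
  case (single m c)
  show ?case
    by (induction y rule: monoid_algebra_induct) (simp_all add: mult_single h exp_map_add distrib_left)
qed (simp add: distrib_right exp_map_add)

lemma lmon_mult: "lmon a * lmon b = lmon (a + b)"
  by (simp add: lmon_def mult_single)

lemma lmon_zero [simp]: "lmon 0 = 1"
  by (simp add: lmon_def)

lemma exp_map_lmon [simp]: "exp_map h (lmon m) = lmon (h m)"
  by (simp add: lmon_def)

lemma single_eq_lmon: "Poly_Mapping.single m c = Poly_Mapping.single 0 c * lmon m"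
  by (simp add: lmon_def mult_single)

lemma eval_at_0 [simp]: "eval_at 0 x = 0"
  and eval_at_pCons: "eval_at (pCons c q) x = Poly_Mapping.single 0 c + x * eval_at q x"
  by (simp_all add: eval_at_def map_poly_pCons)

lemma eval_at_add: "eval_at (q + q') x = eval_at q x + eval_at q' x"
  unfolding eval_at_def
  by (subst poly_add[symmetric], rule arg_cong[of _ _ "\<lambda>q. poly q x"], rule poly_eqI)
    (simp add: coeff_map_poly single_add)

lemma eval_at_smult: "eval_at (smult c q) x = Poly_Mapping.single 0 c * eval_at q x"
  by (induction q) (simp_all add: eval_at_pCons single_zero_mult distrib_left algebra_simps)

lemma eval_at_mult: "eval_at (q * q') x = eval_at q x * eval_at q' x"
  by (induction q) (simp_all add: eval_at_pCons eval_at_add eval_at_smult algebra_simps)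

lemma eval_at_1 [simp]: "eval_at 1 x = 1"
  by (simp add: one_pCons eval_at_pCons)

lemma eval_at_power: "eval_at (q ^ k) x = eval_at q x ^ k"
  by (induction k) (simp_all add: eval_at_mult)

lemma eval_at_monom: "eval_at (monom c i) x = Poly_Mapping.single 0 c * x ^ i"
  by (induction i) (simp_all add: monom_0 monom_Suc eval_at_pCons algebra_simps)

lemma eval_at_sum: "eval_at (sum q I) x = (\<Sum>i\<in>I. eval_at (q i) x)"
  by (induction I rule: infinite_finite_induct) (simp_all add: eval_at_add)

lemma eval_at_eq_sum:
  assumes "degree q \<le> N"
  shows "eval_at q x = (\<Sum>i\<le>N. Poly_Mapping.single 0 (coeff q i) * x ^ i)"
  by (subst poly_as_sum_of_monoms'[OF assms, symmetric]) (simp add: eval_at_sum eval_at_monom)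

lemma exp_map_eval_at:
  assumes h: "\<And>a b. h (a + b) = h a + h b" "h 0 = 0"
  shows "exp_map h (eval_at q x) = eval_at q (exp_map h x)"
  by (induction q) (simp_all add: eval_at_pCons exp_map_add exp_map_mult[OF h(1)] h(2))

text \<open>An additive map of exponents that carries one relation into the ideal of the other induces
  an algebra map of coordinate rings.\<close>

locale exp_hom =
  fixes g :: "'m::comm_monoid_add \<Rightarrow>\<^sub>0 'k::comm_ring_1" and g' :: "'m'::comm_monoid_add \<Rightarrow>\<^sub>0 'k"
    and h :: "'m \<Rightarrow> 'm'" and \<rho> :: "('m \<Rightarrow>\<^sub>0 'k) set \<Rightarrow> ('m' \<Rightarrow>\<^sub>0 'k) set"
  assumes h_add: "h (a + b) = h a + h b" and h_zero: "h 0 = 0"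
    and rel: "g' dvd exp_map h g"
    and \<rho>_def: "\<rho> = induced (\<lambda>x. cls g' (exp_map h x))"
begin

lemma exp_hom_cls: "\<rho> (cls g x) = cls g' (exp_map h x)"
  unfolding \<rho>_def
proof (rule induced_eq)
  fix y assume "y \<in> cls g x"
  then obtain q where "y - x = g * q" by (auto simp: mem_cls_iff dvd_def)
  then have "exp_map h y - exp_map h x = exp_map h g * exp_map h q"
    by (metis exp_map_diff exp_map_mult[OF h_add])
  then show "cls g' (exp_map h y) = cls g' (exp_map h x)"
    using rel by (simp add: cls_eq_iff)
qed (simp add: mem_cls_iff)

sublocale univ_algebra_hom "coord_ring g" "coord_ring g'" \<rho>
proof (intro univ_algebra_hom.intro univ_algebra_hom_axioms.intro univ_algebra_coord_ring)
  have [simp]: "exp_map h 1 = 1"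
    using exp_map_lmon[of h 0] h_zero by simp
  show "\<rho> \<in> ring_hom (coord_ring g) (coord_ring g')"
    by (rule ring_hom_memI)
      (auto elim!: coord_ring_cases simp: coord_ring_simps(2-) exp_hom_cls exp_map_add exp_map_mult[OF h_add])
  show "\<rho> (c \<odot>\<^bsub>coord_ring g\<^esub> \<one>\<^bsub>coord_ring g\<^esub>) = c \<odot>\<^bsub>coord_ring g'\<^esub> \<one>\<^bsub>coord_ring g'\<^esub>" for c
    by (simp add: coord_ring_simps exp_hom_cls h_zero)
qed

lemmas induced_algebra_hom = univ_algebra_hom_axioms

end

section \<open>The charts of the curve\<close>

text \<open>The image of the relative Frobenius consists of linear combinations of \<open>p\<close>-th powers of monomials.
  The exponent map \<open>h\<close> is multiplication by \<open>p\<close>, expressed through monomials because the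
  components of an exponent may be of different types.\<close>
lemma coord_ring_kd_Frobenius:
  fixes g :: "'m::comm_monoid_add \<Rightarrow>\<^sub>0 'k::comm_ring_1" and p :: nat
  assumes p: "of_nat p = (0 :: 'k)" "p > 0" and h: "\<And>m. lmon (h m) = (lmon m ^ p :: 'm \<Rightarrow>\<^sub>0 'k)"
  shows "kd (coord_ring g) (cls g (exp_map h x)) = \<zero>\<^bsub>kaehler (coord_ring g)\<^esub>"
proof -
  interpret univ_algebra "coord_ring g" by (rule univ_algebra_coord_ring)
  show ?thesis
  proof (induction x rule: monoid_algebra_induct)
    case (single m c)
    have "cls g (exp_map h (Poly_Mapping.single m c)) = c \<odot>\<^bsub>coord_ring g\<^esub> (cls g (lmon m) [^]\<^bsub>coord_ring g\<^esub> p)"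
      by (simp add: coord_ring_simps cls_power flip: h) (simp add: lmon_def mult_single)
    then show ?case by (simp add: kd_smult kd_char_power p)
  next
    case (add x y)
    have "cls g (exp_map h (x + y)) = cls g (exp_map h x) \<oplus>\<^bsub>coord_ring g\<^esub> cls g (exp_map h y)"
      by (simp add: exp_map_add coord_ring_simps)
    then show ?case using add by (simp add: kd_add)
  qed
qed

lemma CHAR_monoid_algebra: "CHAR('m::comm_monoid_add \<Rightarrow>\<^sub>0 'k::comm_ring_1) = CHAR('k)"
proof (rule CHAR_eqI)
  show "of_nat CHAR('k) = (0 :: 'm \<Rightarrow>\<^sub>0 'k)"
    by (simp flip: single_of_nat)
  show "CHAR('k) dvd m" if "of_nat m = (0 :: 'm \<Rightarrow>\<^sub>0 'k)" for m
  proof -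
    have "of_nat m = (Poly_Mapping.lookup (of_nat m :: 'm \<Rightarrow>\<^sub>0 'k) 0 :: 'k)"
      by (simp add: lookup_of_nat)
    then show ?thesis using that by (simp add: of_nat_eq_0_iff_char_dvd)
  qed
qed

text \<open>The reflected polynomial is \<open>q(1/t) t\<^sup>d\<close> in a setting where \<open>u\<close> serves as the inverse of \<open>t\<close>.\<close>
lemma eval_at_reflect_poly:
  assumes tu: "t * u = 1"
  shows "t ^ degree q * eval_at (reflect_poly q) u = eval_at q t"
proof -
  let ?l = "degree q"
  have "t ^ ?l * eval_at (reflect_poly q) u =
      (\<Sum>i\<le>?l. Poly_Mapping.single 0 (coeff q (?l - i)) * t ^ (?l - i))"
    unfolding eval_at_eq_sum[OF degree_reflect_poly_le] sum_distrib_left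
  proof (rule sum.cong)
    fix i assume "i \<in> {..?l}"
    then have i: "i \<le> ?l" by simp
    have "t ^ ?l * u ^ i = t ^ (?l - i) * (t * u) ^ i"
      using i by (simp add: power_mult_distrib mult.assoc[symmetric] flip: power_add)
    then have "t ^ ?l * u ^ i = t ^ (?l - i)" using tu by simp
    then show "t ^ ?l * (Poly_Mapping.single 0 (coeff (reflect_poly q) i) * u ^ i) =
        Poly_Mapping.single 0 (coeff q (?l - i)) * t ^ (?l - i)"
      using i by (simp only: coeff_reflect_poly mult.left_commute[of "t ^ ?l"]) simp
  qed simp
  also have "\<dots> = (\<Sum>i\<le>?l. Poly_Mapping.single 0 (coeff q i) * t ^ i)"
    by (rule sum.reindex_bij_witness[of _ "\<lambda>i. ?l - i" "\<lambda>i. ?l - i"]) auto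
  also have "\<dots> = eval_at q t" by (simp add: eval_at_eq_sum[of q ?l])
  finally show ?thesis .
qed

lemma lmon_nat_power: "lmon (a, b) ^ k = (lmon (of_nat k * a, of_nat k * b) :: ('a::comm_semiring_1 \<times> 'b::comm_semiring_1) \<Rightarrow>\<^sub>0 'k::comm_ring_1)"
  by (induction k) (simp_all add: lmon_mult algebra_simps flip: zero_prod_def)

text \<open>The inclusion of charts on exponents; \<open>exp_V\<close> encodes the gluing \<open>s = t\<^sup>-\<^sup>1\<close>, \<open>z = t\<^sup>-\<^sup>r y\<close>.\<close>
abbreviation (input) exp_U :: "nat \<times> int \<Rightarrow> int \<times> int"
  where "exp_U \<equiv> \<lambda>(a, b). (int a, b)"

abbreviation (input) exp_V :: "nat \<Rightarrow> nat \<times> nat \<Rightarrow> int \<times> int"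
  where "exp_V r \<equiv> \<lambda>(a, b). (- int a - int r * int b, int b)"

text \<open>The relation between \<open>r\<close>, \<open>n\<close> and the degree is exactly what makes the equations of the two charts
  correspond under the gluing.  It holds for \<open>f\<close> and for its Frobenius twist, and the locale is used
  for both.\<close>
locale superelliptic =
  fixes n r :: nat and f :: "'k::field poly"
  assumes degree_f: "r * n = degree f + 1"
begin

lemma exp_hom_U: "exp_hom (rel_U n f) (rel_UV n f) exp_U (res_U n f)"
proof
  have "exp_map exp_U (rel_U n f) = rel_UV n f"
    by (simp add: rel_U_def rel_UV_def exp_map_diff exp_map_eval_at zero_prod_def split_beta)
  then show "rel_UV n f dvd exp_map exp_U (rel_U n f)" by simp
qed (auto simp: res_U_def zero_prod_def)

text \<open>Substituting \<open>s = t\<^sup>-\<^sup>1\<close>, \<open>z = t\<^sup>-\<^sup>r y\<close> into \<open>z\<^sup>n - f\<^sub>2(s)\<close> gives \<open>s\<^sup>l\<^sup>+\<^sup>1 (y\<^sup>n - f(t))\<close>, where \<open>l\<close> is the degree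
  of \<open>f\<close> and \<open>r n = l + 1\<close>.\<close>
lemma exp_hom_V: "exp_hom (rel_V n f) (rel_UV n f) (exp_V r) (res_V n r f)"
proof
  let ?t = "lmon (1, 0) :: 'k uv_poly" and ?s = "lmon (- 1, 0) :: 'k uv_poly"
  have st: "?t * ?s = 1" by (simp add: lmon_mult flip: zero_prod_def)
  have ev: "exp_map (exp_V r) (eval_at q (lmon (1, 0))) = eval_at q ?s" for q :: "'k poly"
    by (subst exp_map_eval_at) (auto simp: zero_prod_def algebra_simps)
  have "exp_map (exp_V r) (rel_V n f) = lmon (- int (r * n), int n) - ?s * eval_at (reflect_poly f) ?s"
    by (simp only: rel_V_def exp_map_diff ev) (simp add: inf_poly_def eval_at_pCons)
  also have "eval_at (reflect_poly f) ?s = ?s ^ degree f * eval_at f ?t"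
    by (subst eval_at_reflect_poly[OF st, symmetric])
      (simp add: mult.assoc[symmetric] power_mult_distrib[symmetric] st mult.commute[of ?s])
  also have "lmon (- int (r * n), int n) - ?s * (?s ^ degree f * eval_at f ?t) = ?s ^ (degree f + 1) * rel_UV n f"
  proof -
    have "lmon (- int (r * n), int n) = ?s ^ (degree f + 1) * lmon (0, int n)"
      by (simp only: lmon_nat_power lmon_mult degree_f) simp
    then show ?thesis
      unfolding rel_UV_def right_diff_distrib by (simp add: mult.assoc)
  qed
  finally show "rel_UV n f dvd exp_map (exp_V r) (rel_V n f)" by simp
qed (auto simp: res_V_def zero_prod_def algebra_simps)

sublocale U: univ_algebra "O_U n f" unfolding O_U_def by (rule univ_algebra_coord_ring)
sublocale V: univ_algebra "O_V n f" unfolding O_V_def by (rule univ_algebra_coord_ring)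
sublocale X: univ_algebra "O_UV n f" unfolding O_UV_def by (rule univ_algebra_coord_ring)

sublocale rU: univ_algebra_hom "O_U n f" "O_UV n f" "res_U n f"
  unfolding O_U_def O_UV_def using exp_hom_U by (rule exp_hom.induced_algebra_hom)

sublocale rV: univ_algebra_hom "O_V n f" "O_UV n f" "res_V n r f"
  unfolding O_V_def O_UV_def using exp_hom_V by (rule exp_hom.induced_algebra_hom)

lemmas res_U_cls = exp_hom.exp_hom_cls[OF exp_hom_U]
  and res_V_cls = exp_hom.exp_hom_cls[OF exp_hom_V]

sublocale res\<Omega>_U: abelian_group_hom "\<Omega>_U n f" "\<Omega>_UV n f" "res\<Omega>_U n f"
  unfolding res\<Omega>_U_def by (rule rU.KM.abelian_group_hom_axioms)

sublocale res\<Omega>_V: abelian_group_hom "\<Omega>_V n f" "\<Omega>_UV n f" "res\<Omega>_V n r f"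
  unfolding res\<Omega>_V_def by (rule rV.KM.abelian_group_hom_axioms)

lemma res\<Omega>_d [simp]:
  "x \<in> carrier (O_U n f) \<Longrightarrow> res\<Omega>_U n f (d_U n f x) = d_UV n f (res_U n f x)"
  "y \<in> carrier (O_V n f) \<Longrightarrow> res\<Omega>_V n r f (d_V n f y) = d_UV n f (res_V n r f y)"
  by (simp_all add: res\<Omega>_U_def res\<Omega>_V_def rU.kaehler_map_kd rV.kaehler_map_kd)

end

section \<open>Cocycles, coboundaries and cohomology groups\<close>

lemma prod_module_simps [simp]:
  "carrier (prod_module M N) = carrier M \<times> carrier N"
  "\<zero>\<^bsub>prod_module M N\<^esub> = (\<zero>\<^bsub>M\<^esub>, \<zero>\<^bsub>N\<^esub>)"
  "(x, y) \<oplus>\<^bsub>prod_module M N\<^esub> (x', y') = (x \<oplus>\<^bsub>M\<^esub> x', y \<oplus>\<^bsub>N\<^esub> y')"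
  "c \<odot>\<^bsub>prod_module M N\<^esub> (x, y) = (c \<odot>\<^bsub>M\<^esub> x, c \<odot>\<^bsub>N\<^esub> y)"
  by (simp_all add: prod_module_def)

lemma base_module_simps [simp]:
  "carrier (base_module A M) = carrier M" "\<zero>\<^bsub>base_module A M\<^esub> = \<zero>\<^bsub>M\<^esub>"
  "x \<oplus>\<^bsub>base_module A M\<^esub> y = x \<oplus>\<^bsub>M\<^esub> y"
  "c \<odot>\<^bsub>base_module A M\<^esub> x = (c \<odot>\<^bsub>A\<^esub> \<one>\<^bsub>A\<^esub>) \<odot>\<^bsub>M\<^esub> x"
  by (simp_all add: base_module_def)

context superelliptic
begin

lemma dR_cocycles_iff:
  "(\<omega>, \<omega>', h) \<in> carrier (dR_cocycles n r f) \<longleftrightarrow>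
     \<omega> \<in> carrier (\<Omega>_U n f) \<and> \<omega>' \<in> carrier (\<Omega>_V n f) \<and> h \<in> carrier (O_UV n f) \<and>
     (res\<Omega>_V n r f \<omega>' \<ominus>\<^bsub>\<Omega>_UV n f\<^esub> res\<Omega>_U n f \<omega>) \<oplus>\<^bsub>\<Omega>_UV n f\<^esub> d_UV n f h = \<zero>\<^bsub>\<Omega>_UV n f\<^esub>"
  by (simp add: dR_cocycles_def)

lemma dR_cocycles_simps [simp]:
  "\<zero>\<^bsub>dR_cocycles n r f\<^esub> = (\<zero>\<^bsub>\<Omega>_U n f\<^esub>, \<zero>\<^bsub>\<Omega>_V n f\<^esub>, \<zero>\<^bsub>O_UV n f\<^esub>)"
  "(\<omega>, \<omega>', h) \<oplus>\<^bsub>dR_cocycles n r f\<^esub> (\<eta>, \<eta>', k) = (\<omega> \<oplus>\<^bsub>\<Omega>_U n f\<^esub> \<eta>, \<omega>' \<oplus>\<^bsub>\<Omega>_V n f\<^esub> \<eta>', h \<oplus>\<^bsub>O_UV n f\<^esub> k)"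
  "c \<odot>\<^bsub>dR_cocycles n r f\<^esub> (\<omega>, \<omega>', h) =
    ((c \<odot>\<^bsub>O_U n f\<^esub> \<one>\<^bsub>O_U n f\<^esub>) \<odot>\<^bsub>\<Omega>_U n f\<^esub> \<omega>, (c \<odot>\<^bsub>O_V n f\<^esub> \<one>\<^bsub>O_V n f\<^esub>) \<odot>\<^bsub>\<Omega>_V n f\<^esub> \<omega>', c \<odot>\<^bsub>O_UV n f\<^esub> h)"
  by (simp_all add: dR_cocycles_def prod_module_def)

text \<open>The cocycles are the kernel of this map, whose additivity gives their group structure.\<close>
definition boundary
  where "boundary = (\<lambda>(\<omega>, \<omega>', h).
    (res\<Omega>_V n r f \<omega>' \<ominus>\<^bsub>\<Omega>_UV n f\<^esub> res\<Omega>_U n f \<omega>) \<oplus>\<^bsub>\<Omega>_UV n f\<^esub> d_UV n f h)"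

lemma boundary_add:
  assumes "\<omega> \<in> carrier (\<Omega>_U n f)" "\<omega>' \<in> carrier (\<Omega>_V n f)" "h \<in> carrier (O_UV n f)"
    "\<eta> \<in> carrier (\<Omega>_U n f)" "\<eta>' \<in> carrier (\<Omega>_V n f)" "k \<in> carrier (O_UV n f)"
  shows "boundary (\<omega> \<oplus>\<^bsub>\<Omega>_U n f\<^esub> \<eta>, \<omega>' \<oplus>\<^bsub>\<Omega>_V n f\<^esub> \<eta>', h \<oplus>\<^bsub>O_UV n f\<^esub> k) =
    boundary (\<omega>, \<omega>', h) \<oplus>\<^bsub>\<Omega>_UV n f\<^esub> boundary (\<eta>, \<eta>', k)"
  using assms by (simp add: boundary_def a_minus_def X.K.M.minus_add X.K.M.a_ac)

lemma boundary_uminus: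
  assumes "\<omega> \<in> carrier (\<Omega>_U n f)" "\<omega>' \<in> carrier (\<Omega>_V n f)" "h \<in> carrier (O_UV n f)"
  shows "boundary (\<ominus>\<^bsub>\<Omega>_U n f\<^esub> \<omega>, \<ominus>\<^bsub>\<Omega>_V n f\<^esub> \<omega>', \<ominus>\<^bsub>O_UV n f\<^esub> h) = \<ominus>\<^bsub>\<Omega>_UV n f\<^esub> boundary (\<omega>, \<omega>', h)"
  using assms by (simp add: boundary_def a_minus_def X.K.M.minus_add)

lemma dR_cocycles_boundary:
  "(\<omega>, \<omega>', h) \<in> carrier (dR_cocycles n r f) \<longleftrightarrow>
     \<omega> \<in> carrier (\<Omega>_U n f) \<and> \<omega>' \<in> carrier (\<Omega>_V n f) \<and> h \<in> carrier (O_UV n f) \<and>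
     boundary (\<omega>, \<omega>', h) = \<zero>\<^bsub>\<Omega>_UV n f\<^esub>"
  by (simp add: dR_cocycles_iff boundary_def)

lemma boundary_zero: "boundary (\<zero>\<^bsub>\<Omega>_U n f\<^esub>, \<zero>\<^bsub>\<Omega>_V n f\<^esub>, \<zero>\<^bsub>O_UV n f\<^esub>) = \<zero>\<^bsub>\<Omega>_UV n f\<^esub>"
  by (simp add: boundary_def a_minus_def)

sublocale Z: abelian_group "dR_cocycles n r f"
proof (rule abelian_groupI)
  fix x assume "x \<in> carrier (dR_cocycles n r f)"
  then show "\<exists>y\<in>carrier (dR_cocycles n r f). y \<oplus>\<^bsub>dR_cocycles n r f\<^esub> x = \<zero>\<^bsub>dR_cocycles n r f\<^esub>"
    by (cases x) (auto simp: dR_cocycles_boundary boundary_uminus U.K.M.l_neg V.K.M.l_neg X.l_neg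
      intro!: bexI[of _ "(\<ominus>\<^bsub>\<Omega>_U n f\<^esub> fst x, \<ominus>\<^bsub>\<Omega>_V n f\<^esub> fst (snd x), \<ominus>\<^bsub>O_UV n f\<^esub> snd (snd x))"])
next
  fix x y z assume "x \<in> carrier (dR_cocycles n r f)" "y \<in> carrier (dR_cocycles n r f)"
    "z \<in> carrier (dR_cocycles n r f)"
  then show "(x \<oplus>\<^bsub>dR_cocycles n r f\<^esub> y) \<oplus>\<^bsub>dR_cocycles n r f\<^esub> z = x \<oplus>\<^bsub>dR_cocycles n r f\<^esub> (y \<oplus>\<^bsub>dR_cocycles n r f\<^esub> z)"
    by (cases x, cases y, cases z)
      (simp add: dR_cocycles_boundary U.K.M.a_assoc V.K.M.a_assoc X.a_assoc)
next
  fix x y assume "x \<in> carrier (dR_cocycles n r f)" "y \<in> carrier (dR_cocycles n r f)"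
  then show "x \<oplus>\<^bsub>dR_cocycles n r f\<^esub> y = y \<oplus>\<^bsub>dR_cocycles n r f\<^esub> x"
    by (cases x, cases y)
      (simp add: dR_cocycles_boundary U.K.M.a_comm V.K.M.a_comm X.a_comm)
next
  fix x y assume "x \<in> carrier (dR_cocycles n r f)" "y \<in> carrier (dR_cocycles n r f)"
  then show "x \<oplus>\<^bsub>dR_cocycles n r f\<^esub> y \<in> carrier (dR_cocycles n r f)"
    by (cases x, cases y) (simp add: dR_cocycles_boundary boundary_add)
next
  fix x assume "x \<in> carrier (dR_cocycles n r f)"
  then show "\<zero>\<^bsub>dR_cocycles n r f\<^esub> \<oplus>\<^bsub>dR_cocycles n r f\<^esub> x = x"
    by (cases x) (simp add: dR_cocycles_boundary)
qed (simp add: dR_cocycles_boundary boundary_zero)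

lemma dR_cocycles_uminus:
  assumes "(\<omega>, \<omega>', h) \<in> carrier (dR_cocycles n r f)"
  shows "\<ominus>\<^bsub>dR_cocycles n r f\<^esub> (\<omega>, \<omega>', h) = (\<ominus>\<^bsub>\<Omega>_U n f\<^esub> \<omega>, \<ominus>\<^bsub>\<Omega>_V n f\<^esub> \<omega>', \<ominus>\<^bsub>O_UV n f\<^esub> h)"
  using assms
  by (intro Z.minus_equality)
    (auto simp: dR_cocycles_boundary boundary_uminus U.K.M.l_neg V.K.M.l_neg X.l_neg)

definition dR_cobound
  where "dR_cobound a b = (d_U n f a, \<ominus>\<^bsub>\<Omega>_V n f\<^esub> d_V n f b, res_U n f a \<oplus>\<^bsub>O_UV n f\<^esub> res_V n r f b)"

lemma dR_coboundaries_altdef: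
  "dR_coboundaries n r f = {dR_cobound a b | a b. a \<in> carrier (O_U n f) \<and> b \<in> carrier (O_V n f)}"
  by (simp add: dR_coboundaries_def dR_cobound_def)

text \<open>The cocycle condition for a coboundary reads \<open>- db - da + d(a + b) = 0\<close> on the overlap.\<close>
lemma dR_cobound_closed:
  assumes "a \<in> carrier (O_U n f)" "b \<in> carrier (O_V n f)"
  shows "dR_cobound a b \<in> carrier (dR_cocycles n r f)"
proof -
  have "\<ominus>\<^bsub>\<Omega>_UV n f\<^esub> x \<oplus>\<^bsub>\<Omega>_UV n f\<^esub> (\<ominus>\<^bsub>\<Omega>_UV n f\<^esub> y \<oplus>\<^bsub>\<Omega>_UV n f\<^esub> (y \<oplus>\<^bsub>\<Omega>_UV n f\<^esub> x)) = \<zero>\<^bsub>\<Omega>_UV n f\<^esub>"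
    if "x \<in> carrier (\<Omega>_UV n f)" "y \<in> carrier (\<Omega>_UV n f)" for x y
    using that by (simp add: X.K.M.l_neg X.K.M.r_neg1)
  then show ?thesis
    using assms by (simp add: dR_cobound_def dR_cocycles_boundary boundary_def a_minus_def X.K.M.a_assoc)
qed

sublocale HDR: quotient_group "dR_coboundaries n r f" "dR_cocycles n r f"
proof -
  have "subgroup (dR_coboundaries n r f) (add_monoid (dR_cocycles n r f))"
  proof (rule Z.add.subgroupI)
    show "dR_coboundaries n r f \<subseteq> carrier (dR_cocycles n r f)"
      by (auto simp: dR_coboundaries_altdef dR_cobound_closed)
    show "dR_coboundaries n r f \<noteq> {}"
      using U.zero_closed V.zero_closed unfolding dR_coboundaries_altdef by blast
  next
    fix x assume "x \<in> dR_coboundaries n r f"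
    then obtain a b where ab: "a \<in> carrier (O_U n f)" "b \<in> carrier (O_V n f)" and x: "x = dR_cobound a b"
      by (auto simp: dR_coboundaries_altdef)
    have "\<ominus>\<^bsub>dR_cocycles n r f\<^esub> x = dR_cobound (\<ominus>\<^bsub>O_U n f\<^esub> a) (\<ominus>\<^bsub>O_V n f\<^esub> b)"
      using ab dR_cobound_closed[OF ab] unfolding x
      by (simp add: dR_cobound_def dR_cocycles_uminus X.minus_add)
    then show "\<ominus>\<^bsub>dR_cocycles n r f\<^esub> x \<in> dR_coboundaries n r f"
      using ab unfolding dR_coboundaries_altdef by blast
  next
    fix x y assume "x \<in> dR_coboundaries n r f" "y \<in> dR_coboundaries n r f"
    then obtain a b a' b' where ab: "a \<in> carrier (O_U n f)" "b \<in> carrier (O_V n f)"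
        "a' \<in> carrier (O_U n f)" "b' \<in> carrier (O_V n f)"
      and x: "x = dR_cobound a b" "y = dR_cobound a' b'"
      unfolding dR_coboundaries_altdef by blast
    have "x \<oplus>\<^bsub>dR_cocycles n r f\<^esub> y = dR_cobound (a \<oplus>\<^bsub>O_U n f\<^esub> a') (b \<oplus>\<^bsub>O_V n f\<^esub> b')"
      using ab unfolding x
      by (simp add: dR_cobound_def U.kd_add V.kd_add V.K.M.minus_add X.a_ac)
    then show "x \<oplus>\<^bsub>dR_cocycles n r f\<^esub> y \<in> dR_coboundaries n r f"
      using ab unfolding dR_coboundaries_altdef by blast
  qed
  then show "quotient_group (dR_coboundaries n r f) (dR_cocycles n r f)"
    unfolding quotient_group_def by (intro abelian_subgroupI3 additive_subgroup.intro Z.abelian_group_axioms)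
qed

lemma submodule_coboundaries: "submodule (coboundaries n r f) univ_ring (O_UV n f)"
proof (rule X.U.submoduleI)
  show "coboundaries n r f \<subseteq> carrier (O_UV n f)"
    by (auto simp: coboundaries_def)
  show "\<zero>\<^bsub>O_UV n f\<^esub> \<in> coboundaries n r f"
  proof -
    have "\<zero>\<^bsub>O_UV n f\<^esub> = res_U n f \<zero>\<^bsub>O_U n f\<^esub> \<oplus>\<^bsub>O_UV n f\<^esub> res_V n r f \<zero>\<^bsub>O_V n f\<^esub>" by simp
    then show ?thesis
      unfolding coboundaries_def by (intro CollectI exI conjI) (assumption | rule U.zero_closed V.zero_closed)+
  qed
next
  fix x assume "x \<in> coboundaries n r f"
  then obtain a b where ab: "a \<in> carrier (O_U n f)" "b \<in> carrier (O_V n f)"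
    and x: "x = res_U n f a \<oplus>\<^bsub>O_UV n f\<^esub> res_V n r f b"
    by (auto simp: coboundaries_def)
  have "\<ominus>\<^bsub>O_UV n f\<^esub> x = res_U n f (\<ominus>\<^bsub>O_U n f\<^esub> a) \<oplus>\<^bsub>O_UV n f\<^esub> res_V n r f (\<ominus>\<^bsub>O_V n f\<^esub> b)"
    using ab unfolding x by (simp add: X.minus_add)
  then show "\<ominus>\<^bsub>O_UV n f\<^esub> x \<in> coboundaries n r f"
    using ab unfolding coboundaries_def by blast
  fix c :: 'k
  have "c \<odot>\<^bsub>O_UV n f\<^esub> x = res_U n f (c \<odot>\<^bsub>O_U n f\<^esub> a) \<oplus>\<^bsub>O_UV n f\<^esub> res_V n r f (c \<odot>\<^bsub>O_V n f\<^esub> b)"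
    using ab unfolding x by (simp add: X.U.smult_r_distr rU.hom_smult rV.hom_smult)
  moreover have "c \<odot>\<^bsub>O_U n f\<^esub> a \<in> carrier (O_U n f)" "c \<odot>\<^bsub>O_V n f\<^esub> b \<in> carrier (O_V n f)"
    using ab by simp_all
  ultimately show "c \<odot>\<^bsub>O_UV n f\<^esub> x \<in> coboundaries n r f"
    unfolding coboundaries_def by blast
next
  fix x y assume "x \<in> coboundaries n r f" "y \<in> coboundaries n r f"
  then obtain a b a' b' where ab: "a \<in> carrier (O_U n f)" "b \<in> carrier (O_V n f)"
      "a' \<in> carrier (O_U n f)" "b' \<in> carrier (O_V n f)"
    and x: "x = res_U n f a \<oplus>\<^bsub>O_UV n f\<^esub> res_V n r f b" "y = res_U n f a' \<oplus>\<^bsub>O_UV n f\<^esub> res_V n r f b'"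
    unfolding coboundaries_def by blast
  have "x \<oplus>\<^bsub>O_UV n f\<^esub> y = res_U n f (a \<oplus>\<^bsub>O_U n f\<^esub> a') \<oplus>\<^bsub>O_UV n f\<^esub> res_V n r f (b \<oplus>\<^bsub>O_V n f\<^esub> b')"
    using ab unfolding x by (simp add: X.a_ac)
  then show "x \<oplus>\<^bsub>O_UV n f\<^esub> y \<in> coboundaries n r f"
    using ab unfolding coboundaries_def by blast
qed

sublocale B: quotient_module univ_ring "O_UV n f" "coboundaries n r f"
  by (simp add: quotient_module_def quotient_module_axioms_def X.U.module_axioms submodule_coboundaries)

sublocale H1: Module.module univ_ring "H1O n r f"
  unfolding H1O_def by (rule B.module_quot_module)

sublocale H1c: abelian_group_hom "O_UV n f" "H1O n r f" "H1O_class n r f"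
  unfolding H1O_def H1O_class_def[abs_def] by (rule B.Q.abelian_group_hom_coset)

lemma H1O_class_smult:
  "x \<in> carrier (O_UV n f) \<Longrightarrow> H1O_class n r f (c \<odot>\<^bsub>O_UV n f\<^esub> x) = c \<odot>\<^bsub>H1O n r f\<^esub> H1O_class n r f x"
  unfolding H1O_def H1O_class_def by (simp add: B.coset_smult)

lemma H1O_class_eq_iff:
  "x \<in> carrier (O_UV n f) \<Longrightarrow> y \<in> carrier (O_UV n f) \<Longrightarrow>
    H1O_class n r f x = H1O_class n r f y \<longleftrightarrow> (\<exists>h\<in>coboundaries n r f. x = h \<oplus>\<^bsub>O_UV n f\<^esub> y)"
  unfolding H1O_class_def by (rule B.Q.coset_eq_iff)

lemma H1O_cases:
  assumes "X \<in> carrier (H1O n r f)"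
  obtains x where "x \<in> carrier (O_UV n f)" "X = H1O_class n r f x"
  using assms unfolding H1O_def H1O_class_def by (rule B.Q.coset_cases)

end

section \<open>Monomials on the overlap\<close>

context superelliptic
begin

abbreviation h1_class :: "'k uv_poly \<Rightarrow> 'k uv_poly set set"
  where "h1_class x \<equiv> H1O_class n r f (cls_UV n f x)"

lemma cls_UV_closed [simp]: "cls_UV n f x \<in> carrier (O_UV n f)"
  unfolding O_UV_def by (rule cls_closed)

lemmas O_UV_simps = coord_ring_simps[where g = "rel_UV n f", folded O_UV_def]

lemma h1_class_closed [simp]: "h1_class x \<in> carrier (H1O n r f)"
  by simp

lemma h1_class_add: "h1_class (x + y) = h1_class x \<oplus>\<^bsub>H1O n r f\<^esub> h1_class y"
  by (simp flip: O_UV_simps(2))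

lemma h1_class_smult: "h1_class (Poly_Mapping.single 0 c * x) = c \<odot>\<^bsub>H1O n r f\<^esub> h1_class x"
  by (simp add: H1O_class_smult flip: O_UV_simps(6))

lemma h1_class_zero [simp]: "h1_class 0 = \<zero>\<^bsub>H1O n r f\<^esub>"
  by (simp flip: O_UV_simps(5))

lemma h1_class_cong: "rel_UV n f dvd x - y \<Longrightarrow> h1_class x = h1_class y"
  by (simp flip: cls_eq_iff)

lemma H1O_class_coboundary: "x \<in> coboundaries n r f \<Longrightarrow> H1O_class n r f x = \<zero>\<^bsub>H1O n r f\<^esub>"
  unfolding H1O_class_def H1O_def by (simp add: B.Q.a_rcos_const B.Q.quot_module_simps)

lemma h1_class_U: "h1_class (exp_map exp_U x) = \<zero>\<^bsub>H1O n r f\<^esub>"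
proof (rule H1O_class_coboundary)
  have "cls_U n f x \<in> carrier (O_U n f)" by (simp add: O_U_def)
  moreover from this have "cls_UV n f (exp_map exp_U x) =
      res_U n f (cls_U n f x) \<oplus>\<^bsub>O_UV n f\<^esub> res_V n r f \<zero>\<^bsub>O_V n f\<^esub>"
    by (simp add: res_U_cls)
  ultimately show "cls_UV n f (exp_map exp_U x) \<in> coboundaries n r f"
    unfolding coboundaries_def using V.zero_closed by blast
qed

lemma h1_class_V: "h1_class (exp_map (exp_V r) x) = \<zero>\<^bsub>H1O n r f\<^esub>"
proof (rule H1O_class_coboundary)
  have "cls_V n f x \<in> carrier (O_V n f)" by (simp add: O_V_def)
  moreover from this have "cls_UV n f (exp_map (exp_V r) x) =
      res_U n f \<zero>\<^bsub>O_U n f\<^esub> \<oplus>\<^bsub>O_UV n f\<^esub> res_V n r f (cls_V n f x)"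
    by (simp add: res_V_cls)
  ultimately show "cls_UV n f (exp_map (exp_V r) x) \<in> coboundaries n r f"
    unfolding coboundaries_def using U.zero_closed by blast
qed

lemma h1_class_lmon_U: "e \<ge> 0 \<Longrightarrow> h1_class (lmon (e, b)) = \<zero>\<^bsub>H1O n r f\<^esub>"
  using h1_class_U[of "lmon (nat e, b)"] by simp

lemma h1_class_lmon_V:
  assumes "e \<le> - int (r * b)" shows "h1_class (lmon (e, int b)) = \<zero>\<^bsub>H1O n r f\<^esub>"
  using h1_class_V[of "lmon (nat (- e - int (r * b)), b)"] assms by simp

lemma h1_class_sum:
  assumes "finite I"
  shows "h1_class (\<Sum>i\<in>I. Poly_Mapping.single 0 (c i) * x i) =
    (\<Oplus>\<^bsub>H1O n r f\<^esub>i\<in>I. c i \<odot>\<^bsub>H1O n r f\<^esub> h1_class (x i))"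
  using assms
proof induction
  case (insert i I)
  have "h1_class (\<Sum>i\<in>insert i I. Poly_Mapping.single 0 (c i) * x i) =
      c i \<odot>\<^bsub>H1O n r f\<^esub> h1_class (x i) \<oplus>\<^bsub>H1O n r f\<^esub> (\<Oplus>\<^bsub>H1O n r f\<^esub>i\<in>I. c i \<odot>\<^bsub>H1O n r f\<^esub> h1_class (x i))"
    using insert by (simp add: h1_class_add h1_class_smult)
  also have "\<dots> = (\<Oplus>\<^bsub>H1O n r f\<^esub>i\<in>insert i I. c i \<odot>\<^bsub>H1O n r f\<^esub> h1_class (x i))"
    using insert by (subst H1.M.finsum_insert) auto
  finally show ?case .
qed simp

lemma h1_class_sum_null:
  assumes "\<And>i. i \<in> I \<Longrightarrow> h1_class (x i) = \<zero>\<^bsub>H1O n r f\<^esub>"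
  shows "h1_class (\<Sum>i\<in>I. x i) = \<zero>\<^bsub>H1O n r f\<^esub>"
  using assms by (induction I rule: infinite_finite_induct) (simp_all add: h1_class_add)

lemma lmon_times_eval_at:
  fixes q :: "'k poly" and e b :: int
  assumes "degree q \<le> N"
  shows "lmon (e, b) * eval_at q (lmon (1, 0)) =
    (\<Sum>m\<le>N. Poly_Mapping.single 0 (coeff q m) * lmon (e + int m, b))"
  unfolding eval_at_eq_sum[OF assms] sum_distrib_left
  by (intro sum.cong) (simp_all add: lmon_nat_power lmon_mult mult.left_commute[of "lmon (e, b)"])

text \<open>The relation \<open>y\<^sup>n = f(t)\<close>, raised to the power \<open>a\<close>.\<close>
lemma reduce_power_y:
  "rel_UV n f dvd lmon (e, int (a * n) + b) - lmon (e, b) * eval_at (f ^ a) (lmon (1, 0))"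
proof -
  let ?t = "lmon (1, 0) :: 'k uv_poly" and ?y = "lmon (0, int n) :: 'k uv_poly"
  have "cls_UV n f ?y = cls_UV n f (eval_at f ?t)"
    by (simp add: cls_eq_iff rel_UV_def)
  then have "cls_UV n f (lmon (e, b) * ?y ^ a) = cls_UV n f (lmon (e, b) * eval_at f ?t ^ a)"
    by (simp flip: O_UV_simps(3) cls_power[where g = "rel_UV n f", folded O_UV_def])
  moreover have "lmon (e, b) * ?y ^ a = (lmon (e, int (a * n) + b) :: 'k uv_poly)"
    by (simp add: lmon_nat_power lmon_mult algebra_simps)
  ultimately show ?thesis by (simp add: cls_eq_iff eval_at_power)
qed

text \<open>Replacing \<open>y\<^sup>a\<^sup>n\<close> by \<open>f(t)\<^sup>a\<close> turns the monomial into a combination of the \<open>t\<^sup>-\<^sup>k y\<^sup>b\<close>; those with \<open>k \<le> 0\<close>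
  extend to \<open>U\<close> and those with \<open>k \<ge> r b\<close> extend to \<open>V\<close>.\<close>
lemma h1_class_expand:
  "h1_class (lmon (- e, int (a * n + b))) = (\<Oplus>\<^bsub>H1O n r f\<^esub>k\<in>{1..r * b - 1}.
     zcoeff (f ^ a) (e - int k) \<odot>\<^bsub>H1O n r f\<^esub> h1_class (lmon (- int k, int b)))"
proof -
  let ?F = "f ^ a" and ?D = "degree (f ^ a)"
  define G where "G k = Poly_Mapping.single 0 (zcoeff ?F (e - k)) * (lmon (- k, int b) :: 'k uv_poly)" for k
  \<comment> \<open>The powers of \<open>t\<close> in the expansion lie in \<open>?I\<close>, those of the claim in \<open>?T\<close>; neither contains the other.\<close>
  let ?I = "{e - int ?D..e}" and ?T = "int ` {1..r * b - 1}"
  have null: "h1_class (G k) = \<zero>\<^bsub>H1O n r f\<^esub>" if "k \<notin> ?T" for k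
  proof -
    have "k \<le> 0 \<or> k \<ge> int (r * b)"
    proof (rule ccontr)
      assume "\<not> ?thesis"
      then have "nat k \<in> {1..r * b - 1}" "k = int (nat k)" by (simp_all, linarith)
      then show False using that by blast
    qed
    then have "h1_class (lmon (- k, int b)) = \<zero>\<^bsub>H1O n r f\<^esub>"
      using h1_class_lmon_U[of "- k" "int b"] h1_class_lmon_V[of "- k" b] by auto
    then show ?thesis by (simp add: G_def h1_class_smult)
  qed
  have "h1_class (lmon (- e, int (a * n + b))) = h1_class (lmon (- e, int b) * eval_at ?F (lmon (1, 0)))"
    using reduce_power_y[of "- e" a "int b"] by (intro h1_class_cong) simp
  also have "lmon (- e, int b) * eval_at ?F (lmon (1, 0)) = (\<Sum>k\<in>?I. G k)"
    unfolding lmon_times_eval_at[OF order_refl]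
    by (rule sum.reindex_bij_witness[of _ "\<lambda>k. nat (e - k)" "\<lambda>m. e - int m"])
      (auto simp: G_def zcoeff_def)
  also have "\<dots> = (\<Sum>k\<in>?I \<union> ?T. G k)"
  proof (rule sum.mono_neutral_left)
    have "zcoeff ?F (e - k) = 0" if "k \<notin> ?I" for k
      using that by (auto simp: zcoeff_def intro!: coeff_eq_0)
    then show "\<forall>k\<in>(?I \<union> ?T) - ?I. G k = 0" by (simp add: G_def)
  qed auto
  also have "\<dots> = (\<Sum>k\<in>?I - ?T. G k) + (\<Sum>k\<in>?T. G k)"
    by (subst sum.union_disjoint[symmetric]) (auto intro!: sum.cong)
  also have "h1_class \<dots> = h1_class (\<Sum>k\<in>?T. G k)"
    by (subst h1_class_add, subst h1_class_sum_null) (use null in auto)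
  also have "(\<Sum>k\<in>?T. G k) = (\<Sum>k\<in>{1..r * b - 1}. G (int k))"
    by (simp add: sum.reindex)
  also have "h1_class \<dots> = (\<Oplus>\<^bsub>H1O n r f\<^esub>k\<in>{1..r * b - 1}.
     zcoeff (f ^ a) (e - int k) \<odot>\<^bsub>H1O n r f\<^esub> h1_class (lmon (- int k, int b)))"
    unfolding G_def by (simp add: h1_class_sum)
  finally show ?thesis .
qed

text \<open>The functions regular on \<open>U\<close> or on \<open>V\<close> and the functions \<open>t\<^sup>-\<^sup>i y\<^sup>j\<close> in the indicated range span the
  functions on the overlap.  Stated as an induction principle, this also applies where \<open>P\<close> says
  that two linear maps agree.\<close>
lemma O_UV_span:
  fixes P :: "'k uv_poly \<Rightarrow> bool"
  assumes f0: "poly f 0 \<noteq> 0"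
    and add: "\<And>x y. P x \<Longrightarrow> P y \<Longrightarrow> P (x + y)"
    and smult: "\<And>c x. P x \<Longrightarrow> P (Poly_Mapping.single 0 c * x)"
    and cong: "\<And>x y. P x \<Longrightarrow> rel_UV n f dvd x - y \<Longrightarrow> P y"
    and U: "\<And>e b. e \<ge> 0 \<Longrightarrow> P (lmon (e, b))"
    and V: "\<And>e b. e \<le> - int (r * b) \<Longrightarrow> P (lmon (e, int b))"
    and basis: "\<And>i j. \<lbrakk>1 \<le> j; j \<le> n - 1; 1 \<le> i; i \<le> r * j - 1\<rbrakk> \<Longrightarrow> P (lmon (- int i, int j))"
  shows "P x"
proof -
  have zero: "P 0" using smult[OF U[of 0 0], of 0] by simp
  have sum: "P (\<Sum>i\<in>I. g i)" if "\<And>i. i \<in> I \<Longrightarrow> P (g i)" for I :: "nat set" and g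
    using that by (induction I rule: infinite_finite_induct) (auto simp: zero add)
  have "n \<noteq> 0" using degree_f by (intro notI) simp
  define R where "R e b = (\<Sum>m\<le>degree f. Poly_Mapping.single 0 (coeff f m) * (lmon (e + int m, b) :: 'k uv_poly))" for e b
  have red: "rel_UV n f dvd lmon (e, b + int n) - R e b" for e b
    using reduce_power_y[of e 1 b] by (simp add: R_def lmon_times_eval_at[OF order_refl] add.commute)
  \<comment> \<open>Exponents \<open>b \<ge> n\<close> of \<open>y\<close> are lowered by \<open>y\<^sup>n = f(t)\<close>; for \<open>b < n\<close> the three cases of the hypotheses are exhaustive.\<close>
  have nonneg: "P (lmon (e, int b))" for e b
  proof (induction b arbitrary: e rule: less_induct)
    case (less b)
    show ?case
    proof (cases "b < n")
      case True
      show ?thesis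
      proof (cases "e \<ge> 0 \<or> e \<le> - int (r * b)")
        case False
        then have e: "- int (r * b) < e" "e < 0" by auto
        then have "b \<noteq> 0" by (intro notI) simp
        then have "P (lmon (- int (nat (- e)), int b))"
          using e True by (intro basis; linarith)
        then show ?thesis using e by simp
      qed (use U V in auto)
    next
      case False
      have "P (R e (int (b - n)))"
        unfolding R_def using False \<open>n \<noteq> 0\<close> by (intro sum smult less) simp
      moreover have "rel_UV n f dvd R e (int (b - n)) - lmon (e, int b)"
      proof -
        have "int (b - n) + int n = int b" using False by simp
        then show ?thesis
          using red[of e "int (b - n)"] by (metis dvd_minus_iff minus_diff_eq)
      qed
      ultimately show ?thesis by (rule cong)
    qed
  qed
  \<comment> \<open>Conversely \<open>t\<^sup>e y\<^sup>b\<^sup>+\<^sup>n = f(0) t\<^sup>e y\<^sup>b + \<dots>\<close> with higher powers of \<open>t\<close> in the remainder; the induction starts at the exponents \<open>e \<ge> 0\<close>, which belong to \<open>U\<close>.\<close>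
  have down: "P (lmon (e, b))" if up: "\<And>e. P (lmon (e, b + int n))" for e b
  proof -
    have "P (lmon (e, b))" if "e \<ge> - int m" for m e
      using that
    proof (induction m arbitrary: e)
      case 0
      then show ?case by (simp add: U)
    next
      case (Suc m)
      let ?S = "\<Sum>i<degree f. Poly_Mapping.single 0 (coeff f (Suc i)) * (lmon (e + int (Suc i), b) :: 'k uv_poly)"
      have S: "P ?S" using Suc by (intro sum smult) simp
      have c0: "coeff f 0 \<noteq> 0" using f0 by (simp add: poly_0_coeff_0)
      have "P (lmon (e, b + int n) + Poly_Mapping.single 0 (- 1) * ?S)"
        using up S by (intro add smult)
      moreover have "R e b = Poly_Mapping.single 0 (coeff f 0) * lmon (e, b) + ?S"
        unfolding R_def by (subst sum.atMost_shift) simp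
      then have "rel_UV n f dvd lmon (e, b + int n) + Poly_Mapping.single 0 (- 1) * ?S
          - Poly_Mapping.single 0 (coeff f 0) * lmon (e, b)"
        using red[of e b] by (simp add: single_uminus algebra_simps)
      ultimately have "P (Poly_Mapping.single 0 (coeff f 0) * lmon (e, b))" by (rule cong)
      from smult[OF this, of "inverse (coeff f 0)"] show ?case
        using c0 by (simp add: mult.assoc[symmetric] mult_single)
    qed
    from this[of "nat (- e)" e] show ?thesis by simp
  qed
  \<comment> \<open>Each step of this induction adds \<open>n\<close> to the exponent of \<open>y\<close>, until it is nonnegative.\<close>
  have mon: "P (lmon (e, b))" if "b \<ge> - int (n * N)" for e b N
    using that
  proof (induction N arbitrary: e b)
    case 0
    then show ?case using nonneg[of e "nat b"] by simp
  next
    case (Suc N)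
    show ?case by (rule down, rule Suc.IH) (use Suc.prems in \<open>simp add: algebra_simps\<close>)
  qed
  show ?thesis
  proof (induction x rule: monoid_algebra_induct)
    case (single m c)
    obtain e b where m: "m = (e, b)" by (cases m)
    have "int n * int (nat \<bar>b\<bar>) \<ge> \<bar>b\<bar>"
      using \<open>n \<noteq> 0\<close> mult_right_mono[of 1 "int n" "\<bar>b\<bar>"] by simp
    then have "b \<ge> - int (n * nat \<bar>b\<bar>)" unfolding of_nat_mult by linarith
    then show ?case unfolding m by (subst single_eq_lmon) (intro smult mon)
  qed (rule add)
qed

text \<open>The classes of the functions \<open>t\<^sup>-\<^sup>i y\<^sup>j\<close> span \<open>H\<^sup>1(X\<^sub>0, O)\<close>.\<close>
lemma H1O_endo_eq_id:
  assumes f0: "poly f 0 \<noteq> 0"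
    and T: "abelian_group_hom (H1O n r f) (H1O n r f) T"
    and T_smult: "\<And>c X. X \<in> carrier (H1O n r f) \<Longrightarrow> T (c \<odot>\<^bsub>H1O n r f\<^esub> X) = c \<odot>\<^bsub>H1O n r f\<^esub> T X"
    and basis: "\<And>i j. \<lbrakk>1 \<le> j; j \<le> n - 1; 1 \<le> i; i \<le> r * j - 1\<rbrakk> \<Longrightarrow> T (hclass n r f i j) = hclass n r f i j"
    and X: "X \<in> carrier (H1O n r f)"
  shows "T X = X"
proof -
  interpret T: abelian_group_hom "H1O n r f" "H1O n r f" T by (rule T)
  have "T (h1_class x) = h1_class x" for x
  proof (rule O_UV_span[OF f0, of "\<lambda>x. T (h1_class x) = h1_class x"], goal_cases)
    case (3 x y)
    then show ?case using h1_class_cong[of x y] by simp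
  qed (use basis in \<open>simp_all add: h1_class_add h1_class_smult T_smult h1_class_lmon_U h1_class_lmon_V hclass_def hfun_def\<close>)
  moreover obtain x where "X = h1_class x"
    using X by (auto elim!: H1O_cases simp: O_UV_simps(1))
  ultimately show ?thesis by simp
qed

end

section \<open>The projection of the class of a closed function\<close>

context superelliptic
begin

lemma dR_class_eq_iff:
  "x \<in> carrier (dR_cocycles n r f) \<Longrightarrow> y \<in> carrier (dR_cocycles n r f) \<Longrightarrow>
    dR_class n r f x = dR_class n r f y \<longleftrightarrow>
    (\<exists>a\<in>carrier (O_U n f). \<exists>b\<in>carrier (O_V n f). x = dR_cobound a b \<oplus>\<^bsub>dR_cocycles n r f\<^esub> y)"
  unfolding dR_class_def
  by (subst HDR.coset_eq_iff, assumption, assumption, unfold dR_coboundaries_altdef, blast)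

lemma dR_class_add:
  "x \<in> carrier (dR_cocycles n r f) \<Longrightarrow> y \<in> carrier (dR_cocycles n r f) \<Longrightarrow>
    dR_class n r f x \<oplus>\<^bsub>H1DR n r f\<^esub> dR_class n r f y = dR_class n r f (x \<oplus>\<^bsub>dR_cocycles n r f\<^esub> y)"
  unfolding dR_class_def H1DR_def by (rule HDR.coset_add)

lemma closed_function_cocycle:
  assumes "g \<in> carrier (O_UV n f)" "d_UV n f g = \<zero>\<^bsub>\<Omega>_UV n f\<^esub>"
  shows "(\<zero>\<^bsub>\<Omega>_U n f\<^esub>, \<zero>\<^bsub>\<Omega>_V n f\<^esub>, g) \<in> carrier (dR_cocycles n r f)"
  using assms by (simp add: dR_cocycles_boundary boundary_def a_minus_def)

lemma H1O_class_coboundary_add: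
  assumes "a \<in> carrier (O_U n f)" "b \<in> carrier (O_V n f)" "x \<in> carrier (O_UV n f)"
  shows "H1O_class n r f ((res_U n f a \<oplus>\<^bsub>O_UV n f\<^esub> res_V n r f b) \<oplus>\<^bsub>O_UV n f\<^esub> x) = H1O_class n r f x"
proof -
  have "res_U n f a \<oplus>\<^bsub>O_UV n f\<^esub> res_V n r f b \<in> coboundaries n r f"
    using assms unfolding coboundaries_def by blast
  then show ?thesis using assms by (subst H1O_class_eq_iff) auto
qed

lemma H0\<Omega>_iff:
  "(\<omega>, \<omega>') \<in> carrier (H0\<Omega> n r f) \<longleftrightarrow> \<omega> \<in> carrier (\<Omega>_U n f) \<and> \<omega>' \<in> carrier (\<Omega>_V n f) \<and>
     res\<Omega>_U n f \<omega> = res\<Omega>_V n r f \<omega>'"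
  by (simp add: H0\<Omega>_def)

lemma H0\<Omega>_cocycle:
  assumes "(\<omega>, \<omega>') \<in> carrier (H0\<Omega> n r f)"
  shows "(\<omega>, \<omega>', \<zero>\<^bsub>O_UV n f\<^esub>) \<in> carrier (dR_cocycles n r f)"
  using assms by (simp add: H0\<Omega>_iff dR_cocycles_boundary boundary_def X.K.M.r_neg a_minus_def)

text \<open>The function component of \<open>\<tau>\<close> is linear and, by its prescribed values, a section on a spanning
  set.\<close>
lemma splitting_section:
  assumes f0: "poly f 0 \<noteq> 0" and \<tau>: "is_splitting n r f \<tau>" and X: "X \<in> carrier (H1O n r f)"
    and \<tau>X: "\<tau> X = (\<alpha>, \<alpha>', k)"
  shows "H1O_class n r f k = X" "(\<alpha>, \<alpha>', k) \<in> carrier (dR_cocycles n r f)"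
proof -
  define T where "T X = H1O_class n r f (snd (snd (\<tau> X)))" for X
  have \<tau>_closed: "\<tau> X \<in> carrier (dR_cocycles n r f)" if "X \<in> carrier (H1O n r f)" for X
    using \<tau> that by (auto simp: is_splitting_def semilinear_def)
  then have third: "snd (snd (\<tau> X)) \<in> carrier (O_UV n f)" if "X \<in> carrier (H1O n r f)" for X
    using that by (metis dR_cocycles_boundary prod.collapse)
  have add: "\<tau> (X \<oplus>\<^bsub>H1O n r f\<^esub> Y) = \<tau> X \<oplus>\<^bsub>dR_cocycles n r f\<^esub> \<tau> Y"
    if "X \<in> carrier (H1O n r f)" "Y \<in> carrier (H1O n r f)" for X Y
    using \<tau> that by (auto simp: is_splitting_def semilinear_def)
  have third_add: "snd (snd (x \<oplus>\<^bsub>dR_cocycles n r f\<^esub> y)) = snd (snd x) \<oplus>\<^bsub>O_UV n f\<^esub> snd (snd y)" for x y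
    by (cases x, cases y) simp
  have smult: "\<tau> (c \<odot>\<^bsub>H1O n r f\<^esub> X) = c \<odot>\<^bsub>dR_cocycles n r f\<^esub> \<tau> X"
    if "X \<in> carrier (H1O n r f)" for X c
    using \<tau> that by (auto simp: is_splitting_def semilinear_def)
  have third_smult: "snd (snd (c \<odot>\<^bsub>dR_cocycles n r f\<^esub> x)) = c \<odot>\<^bsub>O_UV n f\<^esub> snd (snd x)" for c x
    by (cases x) simp
  have "T X = X"
  proof (rule H1O_endo_eq_id[OF f0 _ _ _ X])
    show "abelian_group_hom (H1O n r f) (H1O n r f) T"
      by (intro abelian_group_homI H1.M.abelian_group_axioms group_hom.intro
          H1.M.a_group group_hom_axioms.intro homI)
        (simp_all add: T_def third add third_add)
    show "T (c \<odot>\<^bsub>H1O n r f\<^esub> X) = c \<odot>\<^bsub>H1O n r f\<^esub> T X" if "X \<in> carrier (H1O n r f)" for c X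
      using that by (simp add: T_def third smult third_smult H1O_class_smult)
    show "T (hclass n r f i j) = hclass n r f i j"
      if "1 \<le> j" "j \<le> n - 1" "1 \<le> i" "i \<le> r * j - 1" for i j
      using \<tau> that unfolding is_splitting_def T_def by (simp add: hclass_def)
  qed
  then show "H1O_class n r f k = X" by (simp add: T_def \<tau>X)
  show "(\<alpha>, \<alpha>', k) \<in> carrier (dR_cocycles n r f)" using \<tau>_closed[OF X] \<tau>X by simp
qed

text \<open>Write \<open>\<tau>\<close> of the class of \<open>g\<close> as \<open>(\<alpha>, \<alpha>', k)\<close>.  Then \<open>k = a + b + g\<close> with \<open>a\<close> regular on \<open>U\<close> and \<open>b\<close> regular on
  \<open>V\<close>, and subtracting \<open>\<tau>\<close> from \<open>(0, 0, g)\<close> plus the coboundary of \<open>(a, b)\<close> leaves the triple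
  \<open>(da - \<alpha>, - db - \<alpha>', 0)\<close>.  As a cocycle with function component \<open>0\<close> it is a global differential.\<close>
lemma hodge_iso_function_class:
  assumes f0: "poly f 0 \<noteq> 0" and \<tau>: "is_splitting n r f \<tau>"
    and g: "g \<in> carrier (O_UV n f)" "d_UV n f g = \<zero>\<^bsub>\<Omega>_UV n f\<^esub>"
  shows "\<exists>\<omega>\<in>carrier (H0\<Omega> n r f).
    hodge_iso n r f \<tau> (\<omega>, H1O_class n r f g) = dR_class n r f (\<zero>\<^bsub>\<Omega>_U n f\<^esub>, \<zero>\<^bsub>\<Omega>_V n f\<^esub>, g)"
proof -
  let ?d = "dR_cocycles n r f"
  obtain \<alpha> \<alpha>' k where \<tau>g: "\<tau> (H1O_class n r f g) = (\<alpha>, \<alpha>', k)" by (metis prod_cases3)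
  have gX: "H1O_class n r f g \<in> carrier (H1O n r f)" using g by simp
  note k = splitting_section[OF f0 \<tau> gX \<tau>g]
  have carr: "\<alpha> \<in> carrier (\<Omega>_U n f)" "\<alpha>' \<in> carrier (\<Omega>_V n f)" "k \<in> carrier (O_UV n f)"
    and cyc: "boundary (\<alpha>, \<alpha>', k) = \<zero>\<^bsub>\<Omega>_UV n f\<^esub>"
    using k(2) by (auto simp: dR_cocycles_boundary)
  obtain a b where ab: "a \<in> carrier (O_U n f)" "b \<in> carrier (O_V n f)"
    and k_eq: "k = (res_U n f a \<oplus>\<^bsub>O_UV n f\<^esub> res_V n r f b) \<oplus>\<^bsub>O_UV n f\<^esub> g"
    using k(1) carr g by (auto simp: H1O_class_eq_iff coboundaries_def)
  let ?\<omega> = "d_U n f a \<ominus>\<^bsub>\<Omega>_U n f\<^esub> \<alpha>" and ?\<omega>' = "\<ominus>\<^bsub>\<Omega>_V n f\<^esub> d_V n f b \<ominus>\<^bsub>\<Omega>_V n f\<^esub> \<alpha>'"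
  let ?g = "(\<zero>\<^bsub>\<Omega>_U n f\<^esub>, \<zero>\<^bsub>\<Omega>_V n f\<^esub>, g)"
  have gc: "?g \<in> carrier ?d" using g by (rule closed_function_cocycle)
  have sum_closed: "dR_cobound a b \<oplus>\<^bsub>?d\<^esub> ?g \<in> carrier ?d"
    using dR_cobound_closed[OF ab] gc by (rule Z.a_closed)
  have sum_eq: "(?\<omega>, ?\<omega>', \<zero>\<^bsub>O_UV n f\<^esub>) \<oplus>\<^bsub>?d\<^esub> (\<alpha>, \<alpha>', k) = dR_cobound a b \<oplus>\<^bsub>?d\<^esub> ?g"
    using ab carr g
    by (simp add: dR_cobound_def a_minus_def U.K.M.a_assoc V.K.M.a_assoc U.K.M.l_neg V.K.M.l_neg k_eq)
  have \<omega>: "?\<omega> \<in> carrier (\<Omega>_U n f)" "?\<omega>' \<in> carrier (\<Omega>_V n f)"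
    using ab carr by simp_all
  have "boundary (?\<omega>, ?\<omega>', \<zero>\<^bsub>O_UV n f\<^esub>) \<oplus>\<^bsub>\<Omega>_UV n f\<^esub> boundary (\<alpha>, \<alpha>', k) = \<zero>\<^bsub>\<Omega>_UV n f\<^esub>"
    using boundary_add[OF \<omega> X.zero_closed carr] sum_eq sum_closed
    by (simp add: dR_cocycles_boundary dR_cobound_def)
  moreover have "boundary (?\<omega>, ?\<omega>', \<zero>\<^bsub>O_UV n f\<^esub>) \<in> carrier (\<Omega>_UV n f)"
    using \<omega> by (simp add: boundary_def)
  ultimately have "boundary (?\<omega>, ?\<omega>', \<zero>\<^bsub>O_UV n f\<^esub>) = \<zero>\<^bsub>\<Omega>_UV n f\<^esub>"
    unfolding cyc by (simp only: X.K.M.r_zero)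
  then have "res\<Omega>_V n r f ?\<omega>' \<ominus>\<^bsub>\<Omega>_UV n f\<^esub> res\<Omega>_U n f ?\<omega> = \<zero>\<^bsub>\<Omega>_UV n f\<^esub>"
    using \<omega> by (simp add: boundary_def)
  then have "res\<Omega>_U n f ?\<omega> = res\<Omega>_V n r f ?\<omega>'"
    using \<omega> X.K.M.minus_equality X.K.M.minus_minus
    by (metis X.K.M.a_inv_closed a_minus_def res\<Omega>_U.hom_closed res\<Omega>_V.hom_closed)
  then have H0: "(?\<omega>, ?\<omega>') \<in> carrier (H0\<Omega> n r f)"
    using \<omega> by (simp add: H0\<Omega>_iff)
  have "hodge_iso n r f \<tau> ((?\<omega>, ?\<omega>'), H1O_class n r f g) = dR_class n r f (dR_cobound a b \<oplus>\<^bsub>?d\<^esub> ?g)"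
    by (simp add: hodge_iso_def \<tau>g dR_class_add[OF H0\<Omega>_cocycle[OF H0] k(2)] sum_eq del: dR_cocycles_simps)
  also have "\<dots> = dR_class n r f ?g"
    using ab by (subst dR_class_eq_iff[OF sum_closed gc]) blast
  finally show ?thesis using H0 by blast
qed

text \<open>Comparing function components determines the class \<open>X\<close>, while the differential \<open>\<omega>\<close> stays arbitrary.\<close>
lemma hodge_iso_function_class_unique:
  assumes f0: "poly f 0 \<noteq> 0" and \<tau>: "is_splitting n r f \<tau>"
    and g: "g \<in> carrier (O_UV n f)" "d_UV n f g = \<zero>\<^bsub>\<Omega>_UV n f\<^esub>"
    and \<omega>: "\<omega> \<in> carrier (H0\<Omega> n r f)" and X: "X \<in> carrier (H1O n r f)"
    and eq: "hodge_iso n r f \<tau> (\<omega>, X) = dR_class n r f (\<zero>\<^bsub>\<Omega>_U n f\<^esub>, \<zero>\<^bsub>\<Omega>_V n f\<^esub>, g)"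
  shows "X = H1O_class n r f g"
proof -
  let ?d = "dR_cocycles n r f"
  obtain \<alpha> \<alpha>' k where \<tau>X: "\<tau> X = (\<alpha>, \<alpha>', k)" by (metis prod_cases3)
  note k = splitting_section[OF f0 \<tau> X \<tau>X]
  obtain \<beta> \<beta>' where \<beta>: "\<omega> = (\<beta>, \<beta>')" by (cases \<omega>)
  note c = H0\<Omega>_cocycle[OF \<omega>[unfolded \<beta>]]
  have "dR_class n r f ((\<beta>, \<beta>', \<zero>\<^bsub>O_UV n f\<^esub>) \<oplus>\<^bsub>?d\<^esub> (\<alpha>, \<alpha>', k)) = dR_class n r f (\<zero>\<^bsub>\<Omega>_U n f\<^esub>, \<zero>\<^bsub>\<Omega>_V n f\<^esub>, g)"
    using eq by (simp add: hodge_iso_def \<beta> \<tau>X dR_class_add[OF c k(2)] del: dR_cocycles_simps)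
  then obtain a b where ab: "a \<in> carrier (O_U n f)" "b \<in> carrier (O_V n f)"
    and "(\<beta>, \<beta>', \<zero>\<^bsub>O_UV n f\<^esub>) \<oplus>\<^bsub>?d\<^esub> (\<alpha>, \<alpha>', k) = dR_cobound a b \<oplus>\<^bsub>?d\<^esub> (\<zero>\<^bsub>\<Omega>_U n f\<^esub>, \<zero>\<^bsub>\<Omega>_V n f\<^esub>, g)"
    using dR_class_eq_iff[OF Z.a_closed[OF c k(2)] closed_function_cocycle[OF g]] by blast
  then have "k = (res_U n f a \<oplus>\<^bsub>O_UV n f\<^esub> res_V n r f b) \<oplus>\<^bsub>O_UV n f\<^esub> g"
    using k(2) by (simp add: dR_cobound_def dR_cocycles_boundary)
  then show ?thesis using k(1) H1O_class_coboundary_add[OF ab g(1)] by simp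
qed

text \<open>\<open>P1\<close> selects an arbitrary preimage; existence puts the choice into the carrier, and the
  second component is the same for every preimage.\<close>
lemma P1_function_class:
  assumes f0: "poly f 0 \<noteq> 0" and \<tau>: "is_splitting n r f \<tau>"
    and g: "g \<in> carrier (O_UV n f)" "d_UV n f g = \<zero>\<^bsub>\<Omega>_UV n f\<^esub>"
  shows "P1 n r f \<tau> (dR_class n r f (\<zero>\<^bsub>\<Omega>_U n f\<^esub>, \<zero>\<^bsub>\<Omega>_V n f\<^esub>, g)) = H1O_class n r f g"
proof -
  let ?c = "dR_class n r f (\<zero>\<^bsub>\<Omega>_U n f\<^esub>, \<zero>\<^bsub>\<Omega>_V n f\<^esub>, g)"
  let ?S = "carrier (hodge_sum n r f)" and ?\<iota> = "hodge_iso n r f \<tau>"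
  have S: "?S = carrier (H0\<Omega> n r f) \<times> carrier (H1O n r f)" by (simp add: hodge_sum_def)
  have "?c \<in> ?\<iota> ` ?S"
    using hodge_iso_function_class[OF assms] g unfolding S by (auto intro: rev_image_eqI)
  then have "inv_into ?S ?\<iota> ?c \<in> ?S" "?\<iota> (inv_into ?S ?\<iota> ?c) = ?c"
    by (rule inv_into_into, rule f_inv_into_f)
  then show ?thesis
    unfolding P1_def S using hodge_iso_function_class_unique[OF assms]
    by (metis mem_Times_iff prod.collapse)
qed

end

section \<open>The divided Frobenius on functions\<close>

lemma semilinear_zero:
  assumes "semilinear R \<phi> M N \<psi>" "abelian_group M" "abelian_group N"
  shows "\<psi> \<zero>\<^bsub>M\<^esub> = \<zero>\<^bsub>N\<^esub>"
proof -
  interpret M: abelian_group M by fact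
  interpret N: abelian_group N by fact
  have "\<psi> \<zero>\<^bsub>M\<^esub> \<in> carrier N" "\<psi> (\<zero>\<^bsub>M\<^esub> \<oplus>\<^bsub>M\<^esub> \<zero>\<^bsub>M\<^esub>) = \<psi> \<zero>\<^bsub>M\<^esub> \<oplus>\<^bsub>N\<^esub> \<psi> \<zero>\<^bsub>M\<^esub>"
    using assms(1) M.zero_closed unfolding semilinear_def by blast+
  then show ?thesis by simp
qed

locale superelliptic_Frobenius = superelliptic n r f
  for n r :: nat and f :: "'k::field poly" +
  fixes p :: nat
  assumes prime_p: "prime p" and CHAR_p: "CHAR('k) = p"
begin

abbreviation "f' \<equiv> frob_poly p f"

lemma p_pos: "p > 0" using prime_p prime_gt_0_nat by blast

lemma of_nat_p: "of_nat p = (0 :: 'k)" using CHAR_p of_nat_CHAR[where 'a = 'k] by simp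

sublocale T: superelliptic n r f'
proof
  have "degree f' = degree f" using p_pos by (intro degree_map_poly) simp
  then show "r * n = degree f' + 1" using degree_f by simp
qed

lemma frobenius_add: "(x + y) ^ p = x ^ p + (y :: 'm::comm_monoid_add \<Rightarrow>\<^sub>0 'k) ^ p"
  by (rule freshmans_dream) (simp_all add: CHAR_monoid_algebra CHAR_p prime_p)

lemma frobenius_diff: "(x - y) ^ p = x ^ p - (y :: 'm::comm_monoid_add \<Rightarrow>\<^sub>0 'k) ^ p"
  using frobenius_add[of "x - y" y] by simp

lemma single_power_p: "Poly_Mapping.single 0 (c ^ m) = (Poly_Mapping.single 0 c :: 'm::comm_monoid_add \<Rightarrow>\<^sub>0 'k) ^ m"
  by (induction m) (simp_all add: single_zero_mult)

text \<open>The twisted equation, evaluated at \<open>p\<close>-th powers, is the \<open>p\<close>-th power of the equation.\<close>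
lemma eval_at_frob: "eval_at (frob_poly p q) (x ^ p) = (eval_at q x :: 'm::comm_monoid_add \<Rightarrow>\<^sub>0 'k) ^ p"
proof (induction q)
  case (pCons c q)
  have "frob_poly p (pCons c q) = pCons (c ^ p) (frob_poly p q)"
    using p_pos by (simp add: map_poly_pCons)
  then show ?case
    using pCons by (simp add: eval_at_pCons frobenius_add single_power_p power_mult_distrib)
qed (simp add: zero_power[OF p_pos])

text \<open>All that the relative Frobenius of a chart requires is that it takes the twisted relation \<open>g'\<close> to
  \<open>g\<^sup>p\<close>, a multiple of \<open>g\<close>.\<close>
lemma exp_hom_Frobenius:
  fixes g g' :: "'m::comm_monoid_add \<Rightarrow>\<^sub>0 'k"
  assumes "\<And>a b. h (a + b) = h a + h b" "h 0 = 0" "exp_map h g' = g ^ p"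
    "\<rho> = induced (\<lambda>x. cls g (exp_map h x))"
  shows "exp_hom g' g h \<rho>"
  by unfold_locales (use assms p_pos in \<open>auto intro!: dvd_power\<close>)

lemma exp_hom_Fr_U: "exp_hom (rel_U n f') (rel_U n f) (\<lambda>(a, b). (p * a, int p * b)) (Fr_U p n f)"
proof (rule exp_hom_Frobenius)
  show "exp_map (\<lambda>(a, b). (p * a, int p * b)) (rel_U n f') = rel_U n f ^ p"
    by (simp add: rel_U_def exp_map_diff exp_map_eval_at frobenius_diff algebra_simps zero_prod_def
        split_beta lmon_nat_power flip: eval_at_frob)
qed (auto simp: Fr_U_def zero_prod_def algebra_simps)

lemma exp_hom_Fr_V: "exp_hom (rel_V n f') (rel_V n f) (\<lambda>(a, b). (p * a, p * b)) (Fr_V p n f)"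
proof (rule exp_hom_Frobenius)
  have deg: "degree f' = degree f" using degree_f T.degree_f by simp
  have "reflect_poly f' = frob_poly p (reflect_poly f)"
    by (rule poly_eqI) (simp add: coeff_reflect_poly coeff_map_poly deg zero_power[OF p_pos])
  then have "inf_poly f' = frob_poly p (inf_poly f)"
    using p_pos by (simp add: inf_poly_def map_poly_pCons)
  then show "exp_map (\<lambda>(a, b). (p * a, p * b)) (rel_V n f') = rel_V n f ^ p"
    by (simp add: rel_V_def exp_map_diff exp_map_eval_at frobenius_diff algebra_simps zero_prod_def
        split_beta lmon_nat_power flip: eval_at_frob)
qed (auto simp: Fr_V_def zero_prod_def algebra_simps)

lemma exp_hom_Fr_UV: "exp_hom (rel_UV n f') (rel_UV n f) (\<lambda>(a, b). (int p * a, int p * b)) (Fr_UV p n f)"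
proof (rule exp_hom_Frobenius)
  show "exp_map (\<lambda>(a, b). (int p * a, int p * b)) (rel_UV n f') = rel_UV n f ^ p"
    by (simp add: rel_UV_def exp_map_diff exp_map_eval_at frobenius_diff algebra_simps zero_prod_def
        split_beta lmon_nat_power flip: eval_at_frob)
qed (auto simp: Fr_UV_def zero_prod_def algebra_simps)

sublocale FU: univ_algebra_hom "O_U n f'" "O_U n f" "Fr_U p n f"
  unfolding O_U_def using exp_hom_Fr_U by (rule exp_hom.induced_algebra_hom)
sublocale FV: univ_algebra_hom "O_V n f'" "O_V n f" "Fr_V p n f"
  unfolding O_V_def using exp_hom_Fr_V by (rule exp_hom.induced_algebra_hom)
sublocale FX: univ_algebra_hom "O_UV n f'" "O_UV n f" "Fr_UV p n f"
  unfolding O_UV_def using exp_hom_Fr_UV by (rule exp_hom.induced_algebra_hom)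

lemmas Fr_U_cls = exp_hom.exp_hom_cls[OF exp_hom_Fr_U]
  and Fr_V_cls = exp_hom.exp_hom_cls[OF exp_hom_Fr_V]
  and Fr_UV_cls = exp_hom.exp_hom_cls[OF exp_hom_Fr_UV]

lemma d_Fr_U: "a \<in> carrier (O_U n f') \<Longrightarrow> d_U n f (Fr_U p n f a) = \<zero>\<^bsub>\<Omega>_U n f\<^esub>"
  unfolding O_U_def
  by (elim coord_ring_cases, simp only: Fr_U_cls, rule coord_ring_kd_Frobenius[OF of_nat_p p_pos])
    (auto simp: lmon_nat_power)

lemma d_Fr_V: "a \<in> carrier (O_V n f') \<Longrightarrow> d_V n f (Fr_V p n f a) = \<zero>\<^bsub>\<Omega>_V n f\<^esub>"
  unfolding O_V_def
  by (elim coord_ring_cases, simp only: Fr_V_cls, rule coord_ring_kd_Frobenius[OF of_nat_p p_pos])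
    (auto simp: lmon_nat_power)

lemma d_Fr_UV: "a \<in> carrier (O_UV n f') \<Longrightarrow> d_UV n f (Fr_UV p n f a) = \<zero>\<^bsub>\<Omega>_UV n f\<^esub>"
  unfolding O_UV_def
  by (elim coord_ring_cases, simp only: Fr_UV_cls, rule coord_ring_kd_Frobenius[OF of_nat_p p_pos])
    (auto simp: lmon_nat_power)

lemma Fr_res_U: "a \<in> carrier (O_U n f') \<Longrightarrow> Fr_UV p n f (res_U n f' a) = res_U n f (Fr_U p n f a)"
  unfolding O_U_def
  by (elim coord_ring_cases)
    (simp add: Fr_U_cls Fr_UV_cls T.res_U_cls res_U_cls exp_map_comp comp_def split_beta)

lemma Fr_res_V: "a \<in> carrier (O_V n f') \<Longrightarrow> Fr_UV p n f (res_V n r f' a) = res_V n r f (Fr_V p n f a)"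
  unfolding O_V_def
  by (elim coord_ring_cases)
    (simp add: Fr_V_cls Fr_UV_cls T.res_V_cls res_V_cls exp_map_comp comp_def split_beta algebra_simps)

lemma Fr_hfun: "Fr_UV p n f (hfun n f' i j) = hfun n f i j [^]\<^bsub>O_UV n f\<^esub> p"
  unfolding hfun_def O_UV_def by (simp add: Fr_UV_cls cls_power lmon_nat_power)

lemma hfun_power: "hfun n f i j [^]\<^bsub>O_UV n f\<^esub> p = cls_UV n f (lmon (- int (p * i), int (p * j)))"
  unfolding hfun_def O_UV_def by (simp add: cls_power lmon_nat_power)

text \<open>Changing \<open>x\<close> by a coboundary \<open>a + b\<close> changes its Frobenius pullback by those of \<open>a\<close> and \<open>b\<close>, whose
  differentials vanish, so the triple changes by the coboundary of the two pullbacks.\<close>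
lemma induced_Fr_class:
  assumes x: "x \<in> carrier (O_UV n f')"
  shows "induced (\<lambda>x. dR_class n r f (\<zero>\<^bsub>\<Omega>_U n f\<^esub>, \<zero>\<^bsub>\<Omega>_V n f\<^esub>, Fr_UV p n f x)) (H1O_class n r f' x)
    = dR_class n r f (\<zero>\<^bsub>\<Omega>_U n f\<^esub>, \<zero>\<^bsub>\<Omega>_V n f\<^esub>, Fr_UV p n f x)"
proof (rule induced_eq)
  show "x \<in> H1O_class n r f' x" unfolding H1O_class_def using x by (rule T.B.Q.a_rcos_self)
  fix y assume "y \<in> H1O_class n r f' x"
  then obtain a b where ab: "a \<in> carrier (O_U n f')" "b \<in> carrier (O_V n f')"
    and y: "y = (res_U n f' a \<oplus>\<^bsub>O_UV n f'\<^esub> res_V n r f' b) \<oplus>\<^bsub>O_UV n f'\<^esub> x"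
    unfolding H1O_class_def by (auto simp: a_r_coset_def' coboundaries_def)
  let ?z = "\<lambda>x. (\<zero>\<^bsub>\<Omega>_U n f\<^esub>, \<zero>\<^bsub>\<Omega>_V n f\<^esub>, Fr_UV p n f x)"
  have cyc: "?z u \<in> carrier (dR_cocycles n r f)" if "u \<in> carrier (O_UV n f')" for u
    using that by (intro closed_function_cocycle) (simp_all add: d_Fr_UV)
  have y': "y \<in> carrier (O_UV n f')" using ab x unfolding y by simp
  have uminus_zero: "\<ominus>\<^bsub>\<Omega>_V n f\<^esub> \<zero>\<^bsub>\<Omega>_V n f\<^esub> = \<zero>\<^bsub>\<Omega>_V n f\<^esub>"
    by (rule V.K.M.minus_equality) simp_all
  have "?z y = dR_cobound (Fr_U p n f a) (Fr_V p n f b) \<oplus>\<^bsub>dR_cocycles n r f\<^esub> ?z x"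
    using ab x unfolding y by (simp add: dR_cobound_def d_Fr_U d_Fr_V Fr_res_U Fr_res_V uminus_zero)
  moreover have "Fr_U p n f a \<in> carrier (O_U n f)" "Fr_V p n f b \<in> carrier (O_V n f)"
    using ab by simp_all
  ultimately show "dR_class n r f (?z y) = dR_class n r f (?z x)"
    by (subst dR_class_eq_iff[OF cyc[OF y'] cyc[OF x]]) blast
qed

text \<open>On \<open>(0, x)\<close> the differential part of the Deligne-Illusie map contributes the class of
  \<open>(f\<^sub>U 0, f\<^sub>V 0, h 0)\<close>, which is zero by semilinearity.\<close>
lemma DI_map_function_class:
  assumes DI: "DI_maps p n f v fU fV h" and x: "x \<in> carrier (O_UV n f')"
  shows "DI_map p n r f fU fV h (\<zero>\<^bsub>H0\<Omega> n r f'\<^esub>, H1O_class n r f' x) =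
    dR_class n r f (\<zero>\<^bsub>\<Omega>_U n f\<^esub>, \<zero>\<^bsub>\<Omega>_V n f\<^esub>, Fr_UV p n f x)"
proof -
  let ?z = "(\<zero>\<^bsub>\<Omega>_U n f\<^esub>, \<zero>\<^bsub>\<Omega>_V n f\<^esub>, Fr_UV p n f x)"
  have self: "abelian_group (self_module (O_UV n f))"
    by (rule abelian_groupI)
      (auto simp: self_module_def X.a_ac intro!: bexI[of _ "\<ominus>\<^bsub>O_UV n f\<^esub> x" for x] simp: X.l_neg)
  have sl: "semilinear (O_U n f') (Fr_U p n f) (\<Omega>_U n f') (\<Omega>_U n f) fU"
    "semilinear (O_V n f') (Fr_V p n f) (\<Omega>_V n f') (\<Omega>_V n f) fV"
    "semilinear (O_UV n f') (Fr_UV p n f) (\<Omega>_UV n f') (self_module (O_UV n f)) h"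
    using DI unfolding DI_maps_def Let_def by blast+
  have "\<zero>\<^bsub>self_module (O_UV n f)\<^esub> = \<zero>\<^bsub>O_UV n f\<^esub>" by (simp add: self_module_def)
  note zeros = semilinear_zero[OF sl(1) T.U.K.M.abelian_group_axioms U.K.M.abelian_group_axioms]
    semilinear_zero[OF sl(2) T.V.K.M.abelian_group_axioms V.K.M.abelian_group_axioms]
    semilinear_zero[OF sl(3) T.X.K.M.abelian_group_axioms self, unfolded this]
  have z:  "?z \<in> carrier (dR_cocycles n r f)"
    using x by (intro closed_function_cocycle) (simp_all add: d_Fr_UV)
  moreover have "\<zero>\<^bsub>H0\<Omega> n r f'\<^esub> = (\<zero>\<^bsub>\<Omega>_U n f'\<^esub>, \<zero>\<^bsub>\<Omega>_V n f'\<^esub>)"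
    by (simp add: H0\<Omega>_def prod_module_def)
  ultimately show ?thesis
    using x zeros Z.zero_closed Z.l_zero[OF z] by (simp add: DI_map_def induced_Fr_class dR_class_add)
qed

end

theorem proposition6p1:
  fixes p n l r i j a b :: nat
    and \<rho> :: "'w::idom \<Rightarrow> 'k::{field,finite}"
    and \<sigma> :: "'w \<Rightarrow> 'w"
    and fW :: "'w poly" and f v c :: "'k poly"
    and \<tau> :: "'k uv_poly set set \<Rightarrow> 'k triple"
    and fU :: "('k u_poly set \<Rightarrow> 'k u_poly set) set \<Rightarrow> ('k u_poly set \<Rightarrow> 'k u_poly set) set"
    and fV :: "('k v_poly set \<Rightarrow> 'k v_poly set) set \<Rightarrow> ('k v_poly set \<Rightarrow> 'k v_poly set) set"
    and h :: "('k uv_poly set \<Rightarrow> 'k uv_poly set) set \<Rightarrow> 'k uv_poly set"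
    and \<Phi> :: "(('k u_poly set \<Rightarrow> 'k u_poly set) set \<times> ('k v_poly set \<Rightarrow> 'k v_poly set) set) \<times>
      'k uv_poly set set \<Rightarrow> 'k triple set"
  assumes "prime p" and "CHAR('k) = p"
    and "is_witt_ring p \<rho>" and "is_frobenius_lift p \<rho> \<sigma>"
    and "n \<ge> 1" and "coprime n p"
    and "l \<ge> 1" and "n dvd l + 1" and "\<not> p dvd l" and "r = (l + 1) div n"
    and "degree fW = l" and "\<exists>u w. u * fW + w * pderiv fW = 1"
    and "f = map_poly \<rho> fW" and "degree f = l" and "poly f 0 \<noteq> 0"
    and "frobenius_lift_V p n \<rho> \<sigma> (inf_poly fW) v c"
    and "is_splitting n r f \<tau>"
    and "DI_maps p n f v fU fV h"
    and "is_divided_frobenius p n r f fU fV h \<Phi>"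
    and "1 \<le> j" and "j \<le> n - 1" and "1 \<le> i" and "i \<le> r * j - 1"
    and "a = (p * j) div n" and "b = (p * j) mod n"
  shows "1 \<le> b \<and> b \<le> n - 1 \<and>
    P1 n r f \<tau> (\<Phi> (\<zero>\<^bsub>H0\<Omega> n r f\<^esub>, hclass n r f i j)) =
      H1O_class n r f (hfun n f i j [^]\<^bsub>O_UV n f\<^esub> p) \<and>
    H1O_class n r f (hfun n f i j [^]\<^bsub>O_UV n f\<^esub> p) =
      (\<Oplus>\<^bsub>H1O n r f\<^esub>k\<in>{1..r * b - 1}.
         zcoeff (f ^ a) (int (p * i) - int k) \<odot>\<^bsub>H1O n r f\<^esub>
           H1O_class n r f (cls_UV n f (lmon (- int k, int b)))) \<and>
    (\<Oplus>\<^bsub>H1O n r f\<^esub>k\<in>{1..r * b - 1}.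
         zcoeff (f ^ a) (int (p * i) - int k) \<odot>\<^bsub>H1O n r f\<^esub>
           H1O_class n r f (cls_UV n f (lmon (- int k, int b)))) =
      (\<Oplus>\<^bsub>H1O n r f\<^esub>k\<in>{1..r * b - 1}.
         zcoeff (f ^ a) (int (p * i) - int k) \<odot>\<^bsub>H1O n r f\<^esub> hclass n r f k b)"
proof (intro conjI)
  have "r * n = degree f + 1" using assms by simp
  then interpret superelliptic_Frobenius n r f p
    using assms by unfold_locales auto
  have "\<not> n dvd p * j"
  proof
    assume "n dvd p * j"
    then have "n dvd j" using \<open>coprime n p\<close> by (simp add: coprime_dvd_mult_right_iff)
    then have "n \<le> j" using \<open>1 \<le> j\<close> by (intro dvd_imp_le) auto
    then show False using \<open>j \<le> n - 1\<close> \<open>n \<ge> 1\<close> by linarith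
  qed
  then have "b \<noteq> 0" using \<open>b = (p * j) mod n\<close> by (auto simp: mod_eq_0_iff_dvd)
  then show "1 \<le> b" by simp
  have "b < n" using assms by simp
  then show "b \<le> n - 1" by simp
  let ?h = "hfun n f i j [^]\<^bsub>O_UV n f\<^esub> p"
  have hfun_closed: "hfun n f' i j \<in> carrier (O_UV n f')" by (simp add: hfun_def)
  have "\<Phi> (\<zero>\<^bsub>H0\<Omega> n r f\<^esub>, hclass n r f i j) =
      DI_map p n r f fU fV h (\<zero>\<^bsub>H0\<Omega> n r f'\<^esub>, hclass n r f' i j)"
    using assms unfolding is_divided_frobenius_def Let_def by blast
  also have "\<dots> = dR_class n r f (\<zero>\<^bsub>\<Omega>_U n f\<^esub>, \<zero>\<^bsub>\<Omega>_V n f\<^esub>, ?h)"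
    unfolding hclass_def using \<open>DI_maps p n f v fU fV h\<close>
    by (simp only: DI_map_function_class[OF _ hfun_closed] Fr_hfun)
  finally have \<Phi>: "\<Phi> (\<zero>\<^bsub>H0\<Omega> n r f\<^esub>, hclass n r f i j) = \<dots>" .
  have h: "?h \<in> carrier (O_UV n f)" "d_UV n f ?h = \<zero>\<^bsub>\<Omega>_UV n f\<^esub>"
    using d_Fr_UV[OF hfun_closed] by (simp_all add: Fr_hfun hfun_power)
  show "P1 n r f \<tau> (\<Phi> (\<zero>\<^bsub>H0\<Omega> n r f\<^esub>, hclass n r f i j)) = H1O_class n r f ?h"
    unfolding \<Phi> using assms(15,17) h by (rule P1_function_class)
  have "p * j = a * n + b" using assms by simp
  then show "H1O_class n r f ?h = (\<Oplus>\<^bsub>H1O n r f\<^esub>k\<in>{1..r * b - 1}.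
      zcoeff (f ^ a) (int (p * i) - int k) \<odot>\<^bsub>H1O n r f\<^esub>
        H1O_class n r f (cls_UV n f (lmon (- int k, int b))))"
    unfolding hfun_power by (simp only: h1_class_expand)
qed (simp add: hclass_def hfun_def)

end
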